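(* Let $p(t)=(a(t),b(t),c(t))$, $t\in[0,1]$, be a polynomial curve in the Heisenberg group $H_n(\mathbb{R})$, where $a,b$ are polynomial curves in $\mathbb{R}^n$ and $c$ is a real polynomial. Then the dilations $\{\lambda p\}_{\lambda>0}$ equidistribute in the nilmanifold $X_n=H_n(\mathbb{R})/H_n(\mathbb{Z})$ if and only if they equidistribute in the horizontal torus of $X_n$.
   Context: For a unital commutative ring $R$, $H_n(R)$ is the group of $(n+2)\times(n+2)$ upper triangular matrices with $1$'s on the diagonal, first row $(1,x_1,\dots,x_n,z)$, last column $(z,y_1,\dots,y_n,1)^T$ and all other off-diagonal entries $0$, where $x,y\in R^n$, $z\in R$; such an element is denoted $(x,y,z)$. $H_n(\mathbb{Z})$ is a cocompact lattice in the Lie group $H_n(\mathbb{R})$; $X_n=H_n(\mathbb{R})/H_n(\mathbb{Z})$ and $m$ is the unique $H_n(\mathbb{R})$-invariant probability measure on $X_n$. For $\lambda>0$ the dilation is $\lambda(x,y,z)=(\lambda^{1/2}x,\lambda^{1/2}y,\lambda z)$, and $\lambda p$ is the curve $t\mapsto\lambda(p(t))$. Let $\mu_\lambda$ be the push-forward of Lebesgue measure on $[0,1]$ under $t\mapsto \lambda p(t)$ followed by the canonical projection $H_n(\mathbb{R})\to X_n$. The dilations equidistribute in $X_n$ if $\mu_\lambda\to m$ in the weak* topology as $\lambda\to\infty$. The horizontal torus of $X_n$ is the torus $\mathbb{T}^{2n}=\mathbb{R}^{2n}/\mathbb{Z}^{2n}$ given by the $x$- and $y$-coordinates modulo $\mathbb{Z}^{2n}$;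 the dilations equidistribute in it if the push-forwards of Lebesgue measure on $[0,1]$ under $t\mapsto(\lambda^{1/2}a(t),\lambda^{1/2}b(t))\bmod\mathbb{Z}^{2n}$ converge weak* to the Haar probability measure on $\mathbb{T}^{2n}$ as $\lambda\to\infty$. *)

theory Defs
  imports "HOL-Probability.Probability"
begin

section \<open>The Heisenberg group\<close>

text \<open>
  The triple \<open>(x, y, z)\<close> stands for the unipotent matrix with first row \<open>(1, x, z)\<close> and last
  column \<open>(z, y, 1)\<close>, see \<open>heis_matrix\<close> below. The index type \<open>'n\<close> has \<open>n = CARD('n) \<ge> 1\<close>
  elements. The Lie group topology is the product topology of the three coordinates.
\<close>

type_synonym 'n heis = "(real ^ 'n) \<times> (real ^ 'n) \<times> real"

definition heis_mult :: "'n::finite heis \<Rightarrow> 'n heis \<Rightarrow> 'n heis" where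
  "heis_mult = (\<lambda>(x, y, z) (x', y', z'). (x + x', y + y', z + z' + x \<bullet> y'))"

definition heis_one :: "'n::finite heis" where
  "heis_one = (0, 0, 0)"

definition heis_inverse :: "'n::finite heis \<Rightarrow> 'n heis" where
  "heis_inverse = (\<lambda>(x, y, z). (- x, - y, x \<bullet> y - z))"

interpretation heis: group heis_mult heis_one heis_inverse
  by unfold_locales
    (auto simp: heis_mult_def heis_one_def heis_inverse_def inner_add_left inner_add_right
      split: prod.splits)

text \<open>
  The rows and columns are indexed by \<open>'n option option\<close>, where \<open>None\<close> is the first,
  \<open>Some (Some k)\<close> a middle and \<open>Some None\<close> the last position.
\<close>

definition heis_matrix :: "'n::finite heis \<Rightarrow> real ^ 'n option option ^ 'n option option" where
  "heis_matrix = (\<lambda>(x, y, z). \<chi> i j.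
     (case i of
        None \<Rightarrow> (case j of None \<Rightarrow> 1 | Some None \<Rightarrow> z | Some (Some l) \<Rightarrow> x $ l)
      | Some None \<Rightarrow> (if j = Some None then 1 else 0)
      | Some (Some k) \<Rightarrow>
          (case j of None \<Rightarrow> 0 | Some None \<Rightarrow> y $ k | Some (Some l) \<Rightarrow> if k = l then 1 else 0)))"

lemma sum_UNIV_option:
  fixes f :: "'a::finite option \<Rightarrow> 'b::comm_monoid_add"
  shows "sum f UNIV = f None + (\<Sum>k\<in>UNIV. f (Some k))"
  by (simp add: UNIV_option_conv sum.reindex)

lemma heis_matrix_mult: "heis_matrix (heis_mult g h) = heis_matrix g ** heis_matrix h"
  by (auto simp: vec_eq_iff heis_matrix_def heis_mult_def matrix_matrix_mult_def
      sum_UNIV_option inner_vec_def if_distrib[of "\<lambda>u. _ * u"] if_distrib[of "\<lambda>u. u * _"]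
      add.commute cong: if_cong split: option.splits prod.splits)

lemma inj_heis_matrix: "inj heis_matrix"
proof (rule injI)
  fix g h :: "'a::finite heis"
  assume eq: "heis_matrix g = heis_matrix h"
  obtain x y z x' y' z' where gh: "g = (x, y, z)" "h = (x', y', z')"
    by (metis prod_cases3)
  have entry: "heis_matrix g $ i $ j = heis_matrix h $ i $ j" for i j
    using eq by simp
  have "x $ k = x' $ k" "y $ k = y' $ k" "z = z'" for k
    using entry[of None "Some (Some k)"] entry[of "Some (Some k)" "Some None"]
      entry[of None "Some None"]
    by (simp_all add: gh heis_matrix_def)
  then show "g = h"
    by (simp add: gh vec_eq_iff)
qed

text \<open>The subgroup \<open>H\<^sub>n(\<int>)\<close>.\<close>

definition int_vectors :: "(real ^ 'n::finite) set" where
  "int_vectors = {x. \<forall>i. x $ i \<in> \<int>}"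

definition heis_int :: "'n::finite heis set" where
  "heis_int = int_vectors \<times> int_vectors \<times> \<int>"

lemma int_vectors_zero: "0 \<in> int_vectors"
  and int_vectors_add: "x \<in> int_vectors \<Longrightarrow> y \<in> int_vectors \<Longrightarrow> x + y \<in> int_vectors"
  and int_vectors_uminus: "x \<in> int_vectors \<Longrightarrow> - x \<in> int_vectors"
  and int_vectors_inner: "x \<in> int_vectors \<Longrightarrow> y \<in> int_vectors \<Longrightarrow> x \<bullet> y \<in> \<int>"
  by (auto simp: int_vectors_def inner_vec_def)

lemma heis_int_one: "heis_one \<in> heis_int"
  and heis_int_mult: "g \<in> heis_int \<Longrightarrow> h \<in> heis_int \<Longrightarrow> heis_mult g h \<in> heis_int"
  and heis_int_inverse: "g \<in> heis_int \<Longrightarrow> heis_inverse g \<in> heis_int"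
  by (auto simp: heis_int_def heis_one_def heis_mult_def heis_inverse_def int_vectors_zero
      int_vectors_add int_vectors_uminus int_vectors_inner)


section \<open>The nilmanifold and its horizontal torus\<close>

text \<open>The points of the nilmanifold are the left cosets \<open>g H\<^sub>n(\<int>)\<close>.\<close>

definition heis_rel :: "'n::finite heis \<Rightarrow> 'n heis \<Rightarrow> bool" where
  "heis_rel g h \<longleftrightarrow> (\<exists>\<gamma>\<in>heis_int. h = heis_mult g \<gamma>)"

lemma equivp_heis_rel: "equivp (heis_rel :: 'n::finite heis \<Rightarrow> _)"
proof (rule equivpI)
  show "reflp (heis_rel :: 'n heis \<Rightarrow> _)"
    unfolding reflp_def heis_rel_def by (metis heis.right_neutral heis_int_one)
  show "symp (heis_rel :: 'n heis \<Rightarrow> _)"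
    unfolding symp_def heis_rel_def
    by (metis heis.assoc heis.right_inverse heis.right_neutral heis_int_inverse)
  show "transp (heis_rel :: 'n heis \<Rightarrow> _)"
    unfolding transp_def heis_rel_def by (metis heis.assoc heis_int_mult)
qed

quotient_type (overloaded) 'n nilmanifold = "('n::finite) heis" / heis_rel
  by (rule equivp_heis_rel)

lift_definition nil_proj :: "'n::finite heis \<Rightarrow> 'n nilmanifold" is "\<lambda>g. g" .

lift_definition nil_translate :: "'n::finite heis \<Rightarrow> 'n nilmanifold \<Rightarrow> 'n nilmanifold"
  is heis_mult
  unfolding heis_rel_def by (metis heis.assoc)

text \<open>The quotient topology.\<close>

instantiation nilmanifold :: (finite) topological_space
begin

definition open_nilmanifold :: "'a nilmanifold set \<Rightarrow> bool" where
  "open_nilmanifold U \<longleftrightarrow> open (nil_proj -` U)"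

instance
  by standard (auto simp: open_nilmanifold_def vimage_Union)

end

lemma continuous_nil_proj: "continuous_on UNIV nil_proj"
  by (simp add: continuous_on_open_vimage open_nilmanifold_def)

text \<open>The torus \<open>\<real>\<^sup>2\<^sup>n / \<int>\<^sup>2\<^sup>n\<close>, with \<open>\<real>\<^sup>2\<^sup>n\<close> written as the space of pairs \<open>(x, y)\<close>.\<close>

definition torus_rel :: "(real ^ 'n::finite) \<times> (real ^ 'n) \<Rightarrow> (real ^ 'n) \<times> (real ^ 'n) \<Rightarrow> bool" where
  "torus_rel v w \<longleftrightarrow> w - v \<in> int_vectors \<times> int_vectors"

lemma equivp_torus_rel: "equivp (torus_rel :: (real ^ 'n::finite) \<times> (real ^ 'n) \<Rightarrow> _)"
proof (rule equivpI)
  show "reflp (torus_rel :: (real ^ 'n) \<times> (real ^ 'n) \<Rightarrow> _)"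
    by (auto simp: reflp_def torus_rel_def int_vectors_zero zero_prod_def)
  show "symp (torus_rel :: (real ^ 'n) \<times> (real ^ 'n) \<Rightarrow> _)"
  proof (rule sympI)
    fix v w :: "(real ^ 'n) \<times> (real ^ 'n)"
    assume "torus_rel v w"
    then have "- (w - v) \<in> int_vectors \<times> int_vectors"
      by (simp only: torus_rel_def mem_Times_iff fst_uminus snd_uminus int_vectors_uminus)
    then show "torus_rel w v"
      by (simp add: torus_rel_def)
  qed
  show "transp (torus_rel :: (real ^ 'n) \<times> (real ^ 'n) \<Rightarrow> _)"
  proof (rule transpI)
    fix u v w :: "(real ^ 'n) \<times> (real ^ 'n)"
    assume "torus_rel u v" "torus_rel v w"
    then have "(v - u) + (w - v) \<in> int_vectors \<times> int_vectors"
      by (simp only: torus_rel_def mem_Times_iff fst_add snd_add int_vectors_add)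
    then show "torus_rel u w"
      by (simp add: torus_rel_def)
  qed
qed

quotient_type (overloaded) 'n horizontal_torus =
  "(real ^ 'n::finite) \<times> (real ^ 'n)" / torus_rel
  by (rule equivp_torus_rel)

lift_definition torus_proj :: "(real ^ 'n::finite) \<times> (real ^ 'n) \<Rightarrow> 'n horizontal_torus"
  is "\<lambda>v. v" .

lift_definition torus_translate ::
    "(real ^ 'n::finite) \<times> (real ^ 'n) \<Rightarrow> 'n horizontal_torus \<Rightarrow> 'n horizontal_torus"
  is "(+)"
  by (simp add: torus_rel_def)

instantiation horizontal_torus :: (finite) topological_space
begin

definition open_horizontal_torus :: "'a horizontal_torus set \<Rightarrow> bool" where
  "open_horizontal_torus U \<longleftrightarrow> open (torus_proj -` U)"

instance
  by standard (auto simp: open_horizontal_torus_def vimage_Union)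

end

lemma continuous_torus_proj: "continuous_on UNIV torus_proj"
  by (simp add: continuous_on_open_vimage open_horizontal_torus_def)


section \<open>Invariant measures and equidistribution\<close>

text \<open>
  Borel probability measures invariant under an action. For \<open>nil_translate\<close> on the nilmanifold and
  for \<open>torus_translate\<close> on the torus (Haar probability measure) there is exactly one such measure.
\<close>

definition invariant_prob_measure ::
    "('g \<Rightarrow> 'x \<Rightarrow> 'x) \<Rightarrow> 'x::topological_space measure \<Rightarrow> bool" where
  "invariant_prob_measure act m \<longleftrightarrow>
     prob_space m \<and> sets m = sets borel \<and> (\<forall>g. distr m borel (act g) = m)"

text \<open>
  Weak* convergence of Borel probability measures on a compact space; there every continuous
  function is bounded, so the test functions are all continuous ones.
\<close>

definition weak_star_tendsto ::
    "('i \<Rightarrow> 'x::topological_space measure) \<Rightarrow> 'x measure \<Rightarrow> 'i filter \<Rightarrow> bool" where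
  "weak_star_tendsto \<mu> m F \<longleftrightarrow>
     (\<forall>f :: 'x \<Rightarrow> real. continuous_on UNIV f \<longrightarrow>
        ((\<lambda>i. \<integral>x. f x \<partial>\<mu> i) \<longlongrightarrow> (\<integral>x. f x \<partial>m)) F)"

definition heis_dilate :: "real \<Rightarrow> 'n::finite heis \<Rightarrow> 'n heis" where
  "heis_dilate r = (\<lambda>(x, y, z). (sqrt r *\<^sub>R x, sqrt r *\<^sub>R y, r * z))"

definition horizontal :: "'n::finite heis \<Rightarrow> (real ^ 'n) \<times> (real ^ 'n)" where
  "horizontal = (\<lambda>(x, y, z). (x, y))"

definition nil_dilation_measure ::
    "(real \<Rightarrow> 'n::finite heis) \<Rightarrow> real \<Rightarrow> 'n nilmanifold measure" where
  "nil_dilation_measure p r =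
     distr (lebesgue_on {0..1}) borel (\<lambda>t. nil_proj (heis_dilate r (p t)))"

definition torus_dilation_measure ::
    "(real \<Rightarrow> 'n::finite heis) \<Rightarrow> real \<Rightarrow> 'n horizontal_torus measure" where
  "torus_dilation_measure p r =
     distr (lebesgue_on {0..1}) borel (\<lambda>t. torus_proj (horizontal (heis_dilate r (p t))))"

end

theory Submission
  imports Defs
begin

text \<open>
  Write \<open>s = \<lambda>\<^sup>1\<^sup>/\<^sup>2\<close>. By Stone--Weierstrass it suffices to test equidistribution in \<open>X\<^sub>n\<close> against functions
  \<open>H\<close> on which the centre acts by a character \<open>w \<mapsto> exp (2\<pi>ilw)\<close>. For \<open>l = 0\<close> such a function lives on
  the horizontal torus. Equidistribution there forces \<open>k \<bullet> a + k' \<bullet> b\<close> to be nonconstant for all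
  integer vectors \<open>(k, k') \<noteq> 0\<close>, and it then holds on every subinterval of \<open>[0, 1]\<close>.

  Let \<open>l \<noteq> 0\<close> and \<open>q = c' - a' \<bullet> b\<close>. If \<open>q\<close> is not identically zero, the time shift
  \<open>t \<mapsto> t + \<eta> / s\<^sup>2\<close> moves the curve by \<open>\<eta> q(t)\<close> in the central direction up to \<open>o(1)\<close>, and a
  suitable \<open>\<eta>\<close> changes the sign of \<open>H\<close>; so the integral tends to \<open>0\<close>. If \<open>q = 0\<close>, the shift
  \<open>t \<mapsto> t + \<eta> / s\<close> moves the curve by a left translation \<open>g \<eta>\<close> that does not depend on \<open>s\<close> in the
  limit, and the integral is close to that of an average \<open>A\<close> of translates \<open>x \<mapsto> H (g \<eta>\<^sub>j x)\<close>.
  The function \<open>\<bar>A\<bar>\<close> is invariant under the centre, hence its integral along the curve is controlled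
  by the torus, and by van der Corput's trick its mean is small: commuting \<open>g \<eta>\<^sub>j\<close> with a small translation
  in the \<open>y\<close>-direction produces central elements, which make distant translates almost orthogonal.
\<close>

section \<open>Uniform approximation and weak convergence\<close>

definition ei :: "real \<Rightarrow> complex" where
  "ei w = cis (2 * pi * w)"

lemma ei_add: "ei (v + w) = ei v * ei w"
  by (simp add: ei_def cis_mult distrib_left)

lemma ei_0 [simp]: "ei 0 = 1"
  by (simp add: ei_def)

lemma ei_half [simp]: "ei (1 / 2) = -1"
  by (simp add: ei_def)

lemma norm_ei [simp]: "norm (ei w) = 1"
  by (simp add: ei_def)

lemma cnj_ei: "cnj (ei w) = ei (- w)"
  by (simp add: ei_def cis_cnj)

lemma ei_eq_1_iff: "ei w = 1 \<longleftrightarrow> w \<in> \<int>"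
proof
  assume "ei w = 1"
  then have "cos (2 * pi * w) = 1"
    by (simp add: ei_def complex_eq_iff)
  then obtain n :: int where "2 * pi * w = of_int n * 2 * pi"
    unfolding cos_one_2pi_int by blast
  then have "w = of_int n"
    by (simp add: field_simps)
  then show "w \<in> \<int>" by simp
next
  assume "w \<in> \<int>"
  then show "ei w = 1"
    by (simp add: ei_def cis_multiple_2pi)
qed

lemma continuous_on_ei [continuous_intros]:
  "continuous_on S f \<Longrightarrow> continuous_on S (\<lambda>x. ei (f x))"
  unfolding ei_def cis_conv_exp by (intro continuous_intros)

section \<open>Stone-Weierstrass for real parts of complex functions\<close>

text \<open>The families \<open>E\<close> used below are closed under products but not under sums.
  Closing their real parts under addition alone leaves two cases in each induction, so a limit
  checked on \<open>E\<close> passes to all sums by additivity.\<close>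

inductive_set re_sums :: "('a \<Rightarrow> complex) set \<Rightarrow> ('a \<Rightarrow> real) set"
  for E :: "('a \<Rightarrow> complex) set" where
  base: "H \<in> E \<Longrightarrow> (\<lambda>x. Re (H x)) \<in> re_sums E"
| add: "f \<in> re_sums E \<Longrightarrow> g \<in> re_sums E \<Longrightarrow> (\<lambda>x. f x + g x) \<in> re_sums E"

lemma continuous_on_re_sums:
  assumes "\<And>H. H \<in> E \<Longrightarrow> continuous_on UNIV H" and "f \<in> re_sums E"
  shows "continuous_on UNIV f"
  using assms(2) by induction (auto intro!: continuous_intros assms(1))

text \<open>Since Re H Re K is half of Re (HK) plus half of Re (H cnj K), closure of
  \<open>E\<close> under products and conjugation makes the sums of real parts an algebra.
  Separation survives the passage to real parts because \<open>Re (- \<i> * H x)\<close> is the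
  imaginary part of \<open>H x\<close>.\<close>

lemma re_sums_dense:
  fixes E :: "('a::t2_space \<Rightarrow> complex) set"
  assumes compact: "compact (UNIV :: 'a set)"
    and cont: "\<And>H. H \<in> E \<Longrightarrow> continuous_on UNIV H"
    and mult: "\<And>H K. H \<in> E \<Longrightarrow> K \<in> E \<Longrightarrow> (\<lambda>x. H x * K x) \<in> E"
    and cnj: "\<And>H. H \<in> E \<Longrightarrow> (\<lambda>x. cnj (H x)) \<in> E"
    and const: "\<And>c. (\<lambda>x. c) \<in> E"
    and sep: "\<And>x y. x \<noteq> y \<Longrightarrow> \<exists>H\<in>E. H x \<noteq> H y"
    and f: "continuous_on UNIV f" and e: "e > 0"
  shows "\<exists>g\<in>re_sums E. \<forall>x. \<bar>f x - g x\<bar> < e"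
proof -
  have Re_mult: "(\<lambda>x. Re (H x) * Re (K x)) \<in> re_sums E" if "H \<in> E" "K \<in> E" for H K
  proof -
    have "(\<lambda>x. Re (1/2 * (H x * K x)) + Re (1/2 * (H x * cnj (K x)))) \<in> re_sums E"
      by (intro re_sums.intros mult cnj const that)
    moreover have "Re (1/2 * (H x * K x)) + Re (1/2 * (H x * cnj (K x))) = Re (H x) * Re (K x)" for x
      by (simp add: field_simps)
    ultimately show ?thesis by (simp only:)
  qed
  have Re_mult_sum: "(\<lambda>x. Re (H x) * g x) \<in> re_sums E" if "H \<in> E" "g \<in> re_sums E" for H g
    using that(2)
    by induction (simp_all add: Re_mult \<open>H \<in> E\<close> distrib_left re_sums.add)
  have mult_sums: "(\<lambda>x. f x * g x) \<in> re_sums E" if "f \<in> re_sums E" "g \<in> re_sums E" for f g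
    using that(1)
    by induction (simp_all add: Re_mult_sum that(2) distrib_right re_sums.add)
  interpret function_ring_on "re_sums E" UNIV
  proof
    show "compact (UNIV :: 'a set)" by (fact compact)
    show "continuous_on UNIV f" if "f \<in> re_sums E" for f
      using continuous_on_re_sums cont that by blast
    show "(\<lambda>x. f x + g x) \<in> re_sums E" if "f \<in> re_sums E" "g \<in> re_sums E" for f g
      using that by (rule re_sums.add)
    show "(\<lambda>x. f x * g x) \<in> re_sums E" if "f \<in> re_sums E" "g \<in> re_sums E" for f g
      using that by (rule mult_sums)
    show "(\<lambda>_. c) \<in> re_sums E" for c
      using re_sums.base[OF const[of "complex_of_real c"]] by simp
    show "\<exists>f\<in>re_sums E. f x \<noteq> f y" if xy: "x \<noteq> y" for x y
    proof -
      obtain H where H: "H \<in> E" "H x \<noteq> H y"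
        using sep[OF xy] by blast
      have "(\<lambda>x. Re (H x)) \<in> re_sums E"
        using H(1) by (rule re_sums.base)
      moreover have "(\<lambda>x. Re (- \<i> * H x)) \<in> re_sums E"
        by (intro re_sums.base mult const H)
      moreover have "Re (H x) \<noteq> Re (H y) \<or> Re (- \<i> * H x) \<noteq> Re (- \<i> * H y)"
        using H(2) by (auto simp: complex_eq_iff)
      ultimately show ?thesis
        using bexI[where P = "\<lambda>f. f x \<noteq> f y"] by metis
    qed
  qed
  show ?thesis
    using Stone_Weierstrass_basic[OF f e] by simp
qed

text \<open>Preimages of disjoint neighbourhoods of the two values are disjoint. Both quotient
  spaces get their Hausdorff property in this way, from a separating family of functions.\<close>

lemma hausdorff_if_separated:
  fixes x y :: "'a::topological_space"
  assumes "continuous_on UNIV (H :: 'a \<Rightarrow> 'b::t2_space)" and "H x \<noteq> H y"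
  shows "\<exists>U V. open U \<and> open V \<and> x \<in> U \<and> y \<in> V \<and> U \<inter> V = {}"
proof -
  obtain U V where UV: "open U" "open V" "H x \<in> U" "H y \<in> V" "U \<inter> V = {}"
    using hausdorff[OF assms(2)] by blast
  have "open (H -` U)" "open (H -` V)"
    using assms(1) UV(1,2) by (auto simp: continuous_on_open_vimage)
  then show ?thesis
    using UV by (intro exI[of _ "H -` U"] exI[of _ "H -` V"]) auto
qed

section \<open>Convergence of functionals, tested on a dense family\<close>

text \<open>Integrals against a probability measure and integrals along a curve both have this form,
  with \<open>M\<close> the total mass. Additivity carries limits to sums, the Lipschitz bound in
  the sup norm carries them to uniform limits.\<close>

definition bounded_functional ::
    "real \<Rightarrow> (('a::topological_space \<Rightarrow> real) \<Rightarrow> real) \<Rightarrow> bool" where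
  "bounded_functional M \<Lambda> \<longleftrightarrow>
     (\<forall>f g. continuous_on UNIV f \<longrightarrow> continuous_on UNIV g \<longrightarrow> \<Lambda> (\<lambda>x. f x + g x) = \<Lambda> f + \<Lambda> g) \<and>
     (\<forall>f g e. continuous_on UNIV f \<longrightarrow> continuous_on UNIV g \<longrightarrow> (\<forall>x. \<bar>f x - g x\<bar> \<le> e) \<longrightarrow>
        \<bar>\<Lambda> f - \<Lambda> g\<bar> \<le> M * e)"

lemma bounded_functional_tendsto:
  fixes \<Lambda> :: "'i \<Rightarrow> ('a::topological_space \<Rightarrow> real) \<Rightarrow> real"
  assumes \<Lambda>: "\<And>i. bounded_functional M (\<Lambda> i)" and L: "bounded_functional M L"
    and cont: "\<And>H. H \<in> E \<Longrightarrow> continuous_on UNIV H"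
    and dense: "\<And>f e. continuous_on UNIV f \<Longrightarrow> e > 0 \<Longrightarrow> \<exists>g\<in>re_sums E. \<forall>x. \<bar>f x - g x\<bar> < e"
    and lim: "\<And>H. H \<in> E \<Longrightarrow> ((\<lambda>i. \<Lambda> i (\<lambda>x. Re (H x))) \<longlongrightarrow> L (\<lambda>x. Re (H x))) F"
    and f: "continuous_on UNIV f"
  shows "((\<lambda>i. \<Lambda> i f) \<longlongrightarrow> L f) F"
proof (rule tendstoI)
  fix e :: real assume "e > 0"
  \<comment> \<open>A third of \<open>e\<close> for each approximation error and for the convergence
    on \<open>g\<close>; \<open>\<bar>M\<bar> + 1\<close> keeps the denominator positive whatever
    \<open>M\<close> is.\<close>
  define d where "d = e / (3 * (\<bar>M\<bar> + 1))"
  have d: "d > 0" using \<open>e > 0\<close> by (simp add: d_def)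
  have "M * d \<le> (\<bar>M\<bar> + 1) * d"
    using d by (intro mult_right_mono) auto
  also have "\<dots> = e / 3" by (simp add: d_def field_simps)
  finally have Md: "M * d \<le> e / 3" .
  have limR: "((\<lambda>i. \<Lambda> i g) \<longlongrightarrow> L g) F" if "g \<in> re_sums E" for g
    using that
  proof induction
    case (base H)
    then show ?case by (rule lim)
  next
    case (add f g)
    have "continuous_on UNIV f" "continuous_on UNIV g"
      using add.hyps continuous_on_re_sums cont by blast+
    then have "\<Lambda> i (\<lambda>x. f x + g x) = \<Lambda> i f + \<Lambda> i g" "L (\<lambda>x. f x + g x) = L f + L g" for i
      using \<Lambda>[of i] L unfolding bounded_functional_def by blast+
    then show ?case
      using tendsto_add[OF add.IH] by simp
  qed
  obtain g where g: "g \<in> re_sums E" "\<And>x. \<bar>f x - g x\<bar> < d"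
    using dense[OF f d] by blast
  have contg: "continuous_on UNIV g"
    using g(1) continuous_on_re_sums cont by blast
  have fg: "\<forall>x. \<bar>f x - g x\<bar> \<le> d"
    using g(2) by (simp add: less_imp_le)
  have 1: "\<bar>\<Lambda> i f - \<Lambda> i g\<bar> \<le> M * d" for i
    using \<Lambda>[of i] f contg fg unfolding bounded_functional_def by blast
  have 2: "\<bar>L f - L g\<bar> \<le> M * d"
    using L f contg fg unfolding bounded_functional_def by blast
  have "\<forall>\<^sub>F i in F. dist (\<Lambda> i g) (L g) < e / 3"
    using tendstoD[OF limR[OF g(1)], of "e / 3"] \<open>e > 0\<close> by simp
  then show "\<forall>\<^sub>F i in F. dist (\<Lambda> i f) (L f) < e"
  proof eventually_elim
    case (elim i)
    then show ?case
      using 1[of i] 2 Md unfolding dist_real_def by linarith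
  qed
qed

lemma bounded_functional_scale:
  assumes "bounded_functional 1 L" "c \<ge> 0"
  shows "bounded_functional c (\<lambda>f. c * L f)"
proof -
  have "\<bar>c * L f - c * L g\<bar> \<le> c * e" if "\<bar>L f - L g\<bar> \<le> e" for f g e
    using mult_left_mono[OF that assms(2)] assms(2)
    by (simp add: abs_mult flip: right_diff_distrib)
  then show ?thesis
    using assms(1) by (simp add: bounded_functional_def distrib_left)
qed

lemma integrable_continuous_prob:
  fixes f :: "'a::topological_space \<Rightarrow> 'b::{banach, second_countable_topology}"
  assumes compact: "compact (UNIV :: 'a set)" and "prob_space \<mu>" and sets: "sets \<mu> = sets borel"
    and f: "continuous_on UNIV f"
  shows "integrable \<mu> f"
proof -
  interpret prob_space \<mu> by fact
  have "bounded (range f)"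
    using compact_continuous_image[OF f compact] by (rule compact_imp_bounded)
  then obtain C where "\<And>x. norm (f x) \<le> C"
    by (auto simp: bounded_iff)
  moreover have "f \<in> borel_measurable \<mu>"
    using borel_measurable_continuous_onI[OF f] measurable_cong_sets[OF sets refl] by blast
  ultimately show ?thesis
    by (intro integrable_const_bound[of _ C]) auto
qed

lemma bounded_functional_integral:
  fixes \<mu> :: "'a::topological_space measure"
  assumes compact: "compact (UNIV :: 'a set)" and \<mu>: "prob_space \<mu>" "sets \<mu> = sets borel"
  shows "bounded_functional 1 (\<lambda>f. \<integral>x. f x \<partial>\<mu>)"
proof -
  interpret prob_space \<mu> by fact
  note int = integrable_continuous_prob[OF compact \<mu>]
  have "\<bar>(\<integral>x. f x \<partial>\<mu>) - (\<integral>x. g x \<partial>\<mu>)\<bar> \<le> e"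
    if fg: "continuous_on UNIV f" "continuous_on UNIV g" "\<And>x. \<bar>f x - g x\<bar> \<le> e"
    for f g :: "'a \<Rightarrow> real" and e
  proof -
    have diff: "continuous_on UNIV (\<lambda>x. f x - g x)"
      using fg by (intro continuous_intros)
    have "f x - g x \<le> e" "- e \<le> f x - g x" for x
      using fg(3)[of x] by (auto simp: abs_le_iff)
    then have "(\<integral>x. f x - g x \<partial>\<mu>) \<le> e" "- e \<le> (\<integral>x. f x - g x \<partial>\<mu>)"
      by (auto intro!: integral_le_const integral_ge_const int[OF diff])
    then show ?thesis
      using int[OF fg(1)] int[OF fg(2)] by (simp add: Bochner_Integration.integral_diff)
  qed
  then show ?thesis
    unfolding bounded_functional_def by (simp add: int Bochner_Integration.integral_add)
qed

lemma bounded_functional_curve: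
  fixes \<gamma> :: "real \<Rightarrow> 'a::topological_space"
  assumes \<gamma>: "continuous_on UNIV \<gamma>" and uv: "u \<le> v"
  shows "bounded_functional (v - u) (\<lambda>f. integral {u..v} (\<lambda>t. f (\<gamma> t)))"
proof -
  have cont: "continuous_on {u..v} (\<lambda>t. f (\<gamma> t))" if "continuous_on UNIV f" for f :: "'a \<Rightarrow> real"
    using continuous_on_compose2[OF that continuous_on_subset[OF \<gamma>]] by auto
  note int = integrable_continuous_real[OF cont]
  have "\<bar>integral {u..v} (\<lambda>t. f (\<gamma> t)) - integral {u..v} (\<lambda>t. g (\<gamma> t))\<bar> \<le> (v - u) * e"
    if fg: "continuous_on UNIV f" "continuous_on UNIV g" "\<forall>x. \<bar>f x - g x\<bar> \<le> e" for f g e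
  proof -
    have "norm (integral {u..v} (\<lambda>t. f (\<gamma> t) - g (\<gamma> t))) \<le> e * (v - u)"
      using fg by (intro integral_bound uv continuous_intros cont) auto
    then show ?thesis
      by (simp add: Henstock_Kurzweil_Integration.integral_diff int fg mult.commute)
  qed
  then show ?thesis
    unfolding bounded_functional_def
    by (simp add: Henstock_Kurzweil_Integration.integral_add int)
qed

section \<open>The horizontal torus\<close>

lemma invariant_prob_measureD:
  assumes "invariant_prob_measure act m"
  shows "prob_space m" "sets m = sets borel"
  using assms by (simp_all add: invariant_prob_measure_def)

lemma invariant_integral:
  fixes f :: "'x::topological_space \<Rightarrow> real"
  assumes m: "invariant_prob_measure act m" and act: "continuous_on UNIV (act g)"
    and f: "continuous_on UNIV f"
  shows "(\<integral>x. f (act g x) \<partial>m) = (\<integral>x. f x \<partial>m)"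
proof -
  have "act g \<in> borel_measurable m"
    using borel_measurable_continuous_onI[OF act] invariant_prob_measureD(2)[OF m]
      measurable_cong_sets by blast
  then have "(\<integral>x. f (act g x) \<partial>m) = (\<integral>x. f x \<partial>distr m borel (act g))"
    using borel_measurable_continuous_onI[OF f] by (simp add: integral_distr)
  also have "distr m borel (act g) = m"
    using m by (simp add: invariant_prob_measure_def)
  finally show ?thesis .
qed

lemma int_vectors_translate_unit_cube:
  fixes x :: "real ^ 'n::finite"
  shows "\<exists>k\<in>int_vectors. x + k \<in> cbox 0 1"
proof
  show "(\<chi> i. - of_int \<lfloor>x $ i\<rfloor>) \<in> (int_vectors :: (real ^ 'n) set)"
    by (simp add: int_vectors_def)
  show "x + (\<chi> i. - of_int \<lfloor>x $ i\<rfloor>) \<in> cbox 0 1"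
    by (auto simp: mem_box_cart) linarith
qed

lemma torus_proj_eq_iff: "torus_proj v = torus_proj w \<longleftrightarrow> torus_rel v w"
  by transfer simp

lemma surj_torus_proj: "\<exists>v. x = torus_proj v"
  by transfer (metis equivp_reflp equivp_torus_rel)

lemma torus_translate_proj: "torus_translate w (torus_proj v) = torus_proj (w + v)"
  by transfer (metis equivp_reflp equivp_torus_rel)

text \<open>By invariance the choice of representative does not matter. Continuity comes for free
  from the quotient topology, because pulling \<open>H\<close> back along \<open>torus_proj\<close>
  gives \<open>f\<close>.\<close>

lemma torus_lift:
  fixes f :: "(real ^ 'n::finite) \<times> (real ^ 'n) \<Rightarrow> 'b::topological_space"
  assumes f: "continuous_on UNIV f" and inv: "\<And>v w. torus_rel v w \<Longrightarrow> f v = f w"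
  obtains H where "continuous_on UNIV H" "\<And>v. H (torus_proj v) = f v"
proof -
  define H where "H x = f (SOME v. x = torus_proj v)" for x
  have H: "H (torus_proj v) = f v" for v
  proof -
    have "torus_proj v = torus_proj (SOME w. torus_proj v = torus_proj w)"
      by (rule someI[of "\<lambda>w. torus_proj v = torus_proj w" v]) simp
    then have "torus_rel v (SOME w. torus_proj v = torus_proj w)"
      by (simp only: torus_proj_eq_iff)
    then show ?thesis
      unfolding H_def using inv by metis
  qed
  have "torus_proj -` H -` U = f -` U" for U
    by (auto simp: H)
  then have "continuous_on UNIV H"
    using f by (simp add: continuous_on_open_vimage open_horizontal_torus_def)
  then show ?thesis
    using H that by blast
qed

lemma continuous_torus_translate: "continuous_on UNIV (torus_translate w)"
proof -
  have "torus_proj -` torus_translate w -` U = (\<lambda>v. w + v) -` torus_proj -` U" for U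
    by (auto simp: torus_translate_proj)
  moreover have "open ((\<lambda>v. w + v) -` torus_proj -` U)" if "open U" for U
  proof (rule open_vimage)
    show "open (torus_proj -` U)"
      using that by (simp add: open_horizontal_torus_def)
  qed (intro continuous_intros)
  ultimately show ?thesis
    by (simp add: continuous_on_open_vimage open_horizontal_torus_def)
qed

lemma compact_torus: "compact (UNIV :: 'n::finite horizontal_torus set)"
proof -
  have "x \<in> torus_proj ` (cbox 0 1 \<times> cbox 0 1)" for x :: "'n horizontal_torus"
  proof -
    obtain v w where x: "x = torus_proj (v, w)"
      using surj_torus_proj[of x] by auto
    obtain k l where "k \<in> int_vectors" "v + k \<in> cbox 0 1" "l \<in> int_vectors" "w + l \<in> cbox 0 1"
      using int_vectors_translate_unit_cube by blast
    then show ?thesis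
      by (intro image_eqI[of _ _ "(v + k, w + l)"])
        (auto simp: x torus_proj_eq_iff torus_rel_def)
  qed
  then have "(UNIV :: 'n horizontal_torus set) = torus_proj ` (cbox 0 1 \<times> cbox 0 1)"
    by blast
  then show ?thesis
    by (metis compact_Times compact_cbox compact_continuous_image
        continuous_on_subset[OF continuous_torus_proj] subset_UNIV)
qed

section \<open>Characters of the torus and Weyl's criterion\<close>

definition torus_char ::
    "(real ^ 'n::finite) \<times> (real ^ 'n) \<Rightarrow> ('n horizontal_torus \<Rightarrow> complex) \<Rightarrow> bool" where
  "torus_char \<kappa> H \<longleftrightarrow> continuous_on UNIV H \<and>
     (\<forall>v. H (torus_proj v) = H (torus_proj 0) * ei (\<kappa> \<bullet> v))"

definition torus_chars :: "('n::finite horizontal_torus \<Rightarrow> complex) set" where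
  "torus_chars = {H. \<exists>\<kappa>\<in>int_vectors \<times> int_vectors. torus_char \<kappa> H}"

lemma continuous_torus_chars: "H \<in> torus_chars \<Longrightarrow> continuous_on UNIV H"
  by (auto simp: torus_chars_def torus_char_def)

lemma torus_char_exists:
  fixes \<kappa> :: "(real ^ 'n::finite) \<times> (real ^ 'n)"
  assumes "\<kappa> \<in> int_vectors \<times> int_vectors"
  obtains H where "torus_char \<kappa> H" "\<And>v. H (torus_proj v) = ei (\<kappa> \<bullet> v)"
proof -
  have inv: "ei (\<kappa> \<bullet> v) = ei (\<kappa> \<bullet> w)" if "torus_rel v w" for v w
  proof -
    have "\<kappa> \<bullet> (w - v) \<in> \<int>"
      using assms that int_vectors_inner
      by (cases \<kappa>; cases v; cases w) (auto simp: torus_rel_def inner_Pair intro!: Ints_add)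
    then have "ei (\<kappa> \<bullet> v + \<kappa> \<bullet> (w - v)) = ei (\<kappa> \<bullet> v)"
      by (simp add: ei_add flip: ei_eq_1_iff)
    then show ?thesis
      by (simp add: inner_diff_right)
  qed
  have "continuous_on UNIV (\<lambda>v. ei (\<kappa> \<bullet> v))"
    by (intro continuous_intros)
  from torus_lift[OF this inv] obtain H where
    H: "continuous_on UNIV H" "\<And>v. H (torus_proj v) = ei (\<kappa> \<bullet> v)"
    by blast
  then show ?thesis
    using that by (simp add: torus_char_def)
qed

text \<open>Distinct points differ by a vector with a non-integral coordinate, and the character
  whose frequency is the corresponding unit vector detects it.\<close>

lemma torus_chars_separate:
  fixes x y :: "'n::finite horizontal_torus"
  assumes "x \<noteq> y"
  shows "\<exists>H\<in>torus_chars. H x \<noteq> H y"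
proof -
  obtain v w where xy: "x = torus_proj v" "y = torus_proj w"
    using surj_torus_proj by blast
  have "\<not> torus_rel v w"
    using assms by (simp add: xy torus_proj_eq_iff)
  then obtain i where "fst (w - v) $ i \<notin> \<int> \<or> snd (w - v) $ i \<notin> \<int>"
    by (auto simp: torus_rel_def int_vectors_def mem_Times_iff)
  then have "(axis i 1, 0) \<bullet> (w - v) \<notin> \<int> \<or> (0, axis i 1) \<bullet> (w - v) \<notin> \<int>"
    by (auto simp: inner_prod_def inner_axis')
  moreover have "axis i 1 \<in> (int_vectors :: (real ^ 'n) set)"
    by (auto simp: int_vectors_def axis_def)
  ultimately obtain \<kappa> :: "(real ^ 'n) \<times> (real ^ 'n)"
    where \<kappa>: "\<kappa> \<in> int_vectors \<times> int_vectors" "\<kappa> \<bullet> (w - v) \<notin> \<int>"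
    using int_vectors_zero by (metis SigmaI)
  obtain H where H: "torus_char \<kappa> H" "\<And>v. H (torus_proj v) = ei (\<kappa> \<bullet> v)"
    using torus_char_exists[OF \<kappa>(1)] by blast
  have "ei (\<kappa> \<bullet> w) = ei (\<kappa> \<bullet> v) * ei (\<kappa> \<bullet> (w - v))"
    by (simp add: inner_diff_right flip: ei_add)
  moreover have "ei (\<kappa> \<bullet> v) \<noteq> 0"
    using norm_ei[of "\<kappa> \<bullet> v"] by (metis norm_zero zero_neq_one)
  ultimately have "H x \<noteq> H y"
    using \<kappa>(2) by (simp add: xy H ei_eq_1_iff)
  then show ?thesis
    using H(1) \<kappa>(1) by (auto simp: torus_chars_def)
qed

instance horizontal_torus :: (finite) t2_space
proof
  fix x y :: "'a horizontal_torus"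
  assume "x \<noteq> y"
  then show "\<exists>U V. open U \<and> open V \<and> x \<in> U \<and> y \<in> V \<and> U \<inter> V = {}"
    by (meson torus_chars_separate continuous_torus_chars hausdorff_if_separated)
qed

lemma torus_chars_dense:
  fixes f :: "'n::finite horizontal_torus \<Rightarrow> real"
  assumes "continuous_on UNIV f" and "e > 0"
  shows "\<exists>g\<in>re_sums torus_chars. \<forall>x. \<bar>f x - g x\<bar> < e"
proof (rule re_sums_dense[OF compact_torus continuous_torus_chars _ _ _ torus_chars_separate assms])
  fix H K :: "'n horizontal_torus \<Rightarrow> complex"
  assume "H \<in> torus_chars" "K \<in> torus_chars"
  then obtain \<kappa> \<kappa>' where \<kappa>: "\<kappa> \<in> int_vectors \<times> int_vectors" "\<kappa>' \<in> int_vectors \<times> int_vectors"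
    and H: "torus_char \<kappa> H" and K: "torus_char \<kappa>' K"
    by (auto simp: torus_chars_def)
  have "H (torus_proj v) * K (torus_proj v) =
      H (torus_proj 0) * K (torus_proj 0) * ei ((\<kappa> + \<kappa>') \<bullet> v)" for v
  proof -
    have "H (torus_proj v) = H (torus_proj 0) * ei (\<kappa> \<bullet> v)"
      "K (torus_proj v) = K (torus_proj 0) * ei (\<kappa>' \<bullet> v)"
      using H K unfolding torus_char_def by blast+
    then show ?thesis
      by (simp only: inner_add_left ei_add mult.assoc mult.left_commute)
  qed
  moreover have "continuous_on UNIV (\<lambda>x. H x * K x)"
    using H K by (intro continuous_intros) (simp_all add: torus_char_def)
  ultimately have "torus_char (\<kappa> + \<kappa>') (\<lambda>x. H x * K x)"
    unfolding torus_char_def by blast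
  moreover have "\<kappa> + \<kappa>' \<in> int_vectors \<times> int_vectors"
    using \<kappa> by (simp add: mem_Times_iff int_vectors_add)
  ultimately show "(\<lambda>x. H x * K x) \<in> torus_chars"
    unfolding torus_chars_def mem_Collect_eq by (rule bexI)
next
  fix H :: "'n horizontal_torus \<Rightarrow> complex"
  assume "H \<in> torus_chars"
  then obtain \<kappa> where \<kappa>: "\<kappa> \<in> int_vectors \<times> int_vectors" and H: "torus_char \<kappa> H"
    by (auto simp: torus_chars_def)
  have "cnj (H (torus_proj v)) = cnj (H (torus_proj 0)) * ei (- \<kappa> \<bullet> v)" for v
  proof -
    have "H (torus_proj v) = H (torus_proj 0) * ei (\<kappa> \<bullet> v)"
      using H unfolding torus_char_def by blast
    then show ?thesis
      by (simp only: complex_cnj_mult cnj_ei inner_minus_left)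
  qed
  moreover have "continuous_on UNIV (\<lambda>x. cnj (H x))"
    using H by (intro continuous_intros) (simp add: torus_char_def)
  ultimately have "torus_char (- \<kappa>) (\<lambda>x. cnj (H x))"
    unfolding torus_char_def by blast
  moreover have "- \<kappa> \<in> int_vectors \<times> int_vectors"
    using \<kappa> by (simp add: mem_Times_iff int_vectors_uminus)
  ultimately show "(\<lambda>x. cnj (H x)) \<in> torus_chars"
    unfolding torus_chars_def mem_Collect_eq by (rule bexI)
next
  fix c :: complex
  have "torus_char 0 (\<lambda>x :: 'n horizontal_torus. c)"
    by (simp add: torus_char_def)
  moreover have "0 \<in> (int_vectors \<times> int_vectors :: ((real ^ 'n) \<times> (real ^ 'n)) set)"
    by (simp add: mem_Times_iff int_vectors_zero)
  ultimately show "(\<lambda>x :: 'n horizontal_torus. c) \<in> torus_chars"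
    unfolding torus_chars_def mem_Collect_eq by (rule bexI)
qed

text \<open>Translation by a half period, a vector \<open>w\<close> with
  \<open>\<kappa> \<bullet> w = 1 / 2\<close>, changes the sign of \<open>H\<close> but not its
  integral.\<close>

lemma torus_char_integral_zero:
  assumes h: "invariant_prob_measure torus_translate h"
    and H: "torus_char \<kappa> H" and \<kappa>: "\<kappa> \<noteq> 0"
  shows "(\<integral>x. Re (H x) \<partial>h) = 0"
proof -
  define w where "w = (1 / (2 * (\<kappa> \<bullet> \<kappa>))) *\<^sub>R \<kappa>"
  have w: "\<kappa> \<bullet> w = 1 / 2"
    using \<kappa> by (simp add: w_def)
  have neg: "H (torus_translate w x) = - H x" for x
  proof -
    obtain v where x: "x = torus_proj v"
      using surj_torus_proj by blast
    have 1: "H (torus_proj (w + v)) = H (torus_proj 0) * ei (\<kappa> \<bullet> (w + v))"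
      and 2: "H (torus_proj v) = H (torus_proj 0) * ei (\<kappa> \<bullet> v)"
      using H unfolding torus_char_def by blast+
    show ?thesis
      unfolding x torus_translate_proj 1 2 inner_add_right ei_add w ei_half by simp
  qed
  have "continuous_on UNIV (\<lambda>x. Re (H x))"
    using H by (auto simp: torus_char_def intro!: continuous_intros)
  from invariant_integral[OF h continuous_torus_translate this, of w] show ?thesis
    by (simp add: neg)
qed

text \<open>Weyl's criterion: by density of the characters only nonzero integer frequencies have to
  be tested. The mass \<open>M\<close> is left general so that integrals over subintervals of a
  curve are covered.\<close>

lemma torus_weyl:
  fixes \<Lambda> :: "'i \<Rightarrow> ('n::finite horizontal_torus \<Rightarrow> real) \<Rightarrow> real"
  assumes h: "invariant_prob_measure torus_translate h"
    and \<Lambda>: "\<And>i. bounded_functional M (\<Lambda> i)" and "M \<ge> 0"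
    and const: "\<And>c. ((\<lambda>i. \<Lambda> i (\<lambda>x. c)) \<longlongrightarrow> M * c) F"
    and lim: "\<And>\<kappa> H. \<kappa> \<in> int_vectors \<times> int_vectors \<Longrightarrow> \<kappa> \<noteq> 0 \<Longrightarrow> torus_char \<kappa> H \<Longrightarrow>
      ((\<lambda>i. \<Lambda> i (\<lambda>x. Re (H x))) \<longlongrightarrow> 0) F"
    and f: "continuous_on UNIV f"
  shows "((\<lambda>i. \<Lambda> i f) \<longlongrightarrow> M * (\<integral>x. f x \<partial>h)) F"
proof (rule bounded_functional_tendsto[OF \<Lambda> _ continuous_torus_chars torus_chars_dense _ f])
  note prob = invariant_prob_measureD[OF h]
  interpret prob_space h by (fact prob)
  show "bounded_functional M (\<lambda>f. M * (\<integral>x. f x \<partial>h))"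
    using bounded_functional_scale[OF bounded_functional_integral[OF compact_torus prob] \<open>M \<ge> 0\<close>] .
  fix H :: "'n horizontal_torus \<Rightarrow> complex"
  assume "H \<in> torus_chars"
  then obtain \<kappa> where \<kappa>: "\<kappa> \<in> int_vectors \<times> int_vectors" "torus_char \<kappa> H"
    by (auto simp: torus_chars_def)
  show "((\<lambda>i. \<Lambda> i (\<lambda>x. Re (H x))) \<longlongrightarrow> M * (\<integral>x. Re (H x) \<partial>h)) F"
  proof (cases "\<kappa> = 0")
    case True
    have "H x = H (torus_proj 0)" for x
    proof -
      obtain v where x: "x = torus_proj v"
        using surj_torus_proj by blast
      have "H (torus_proj v) = H (torus_proj 0) * ei (\<kappa> \<bullet> v)"
        using \<kappa>(2) unfolding torus_char_def by blast
      then show ?thesis by (simp add: x True)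
    qed
    then have "(\<lambda>x. Re (H x)) = (\<lambda>x. Re (H (torus_proj 0)))"
      by (metis (no_types))
    then show ?thesis
      using const[of "Re (H (torus_proj 0))"] by (simp add: prob_space)
  next
    case False
    then show ?thesis
      using lim \<kappa> torus_char_integral_zero[OF h] by fastforce
  qed
qed

text \<open>Weyl's criterion applied to a constant sequence: all nontrivial characters have integral
  zero under \<open>h'\<close> as well, so the constant sequence converges to the integral under
  \<open>h\<close>.\<close>

lemma torus_invariant_measure_unique:
  fixes f :: "'n::finite horizontal_torus \<Rightarrow> real"
  assumes h: "invariant_prob_measure torus_translate h"
    and h': "invariant_prob_measure torus_translate h'" and f: "continuous_on UNIV f"
  shows "(\<integral>x. f x \<partial>h') = (\<integral>x. f x \<partial>h)"
proof -
  note prob = invariant_prob_measureD[OF h']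
  interpret prob_space h' by (fact prob)
  have "((\<lambda>i::nat. \<integral>x. f x \<partial>h') \<longlongrightarrow> 1 * (\<integral>x. f x \<partial>h)) sequentially"
    by (rule torus_weyl[OF h bounded_functional_integral[OF compact_torus prob] _ _ _ f])
      (auto simp: prob_space torus_char_integral_zero[OF h'])
  then show ?thesis
    using LIMSEQ_const_iff by fastforce
qed

section \<open>The nilmanifold and its vertical characters\<close>

lemma nil_proj_eq_iff: "nil_proj g = nil_proj h \<longleftrightarrow> heis_rel g h"
  by transfer simp

lemma surj_nil_proj: "\<exists>g. x = nil_proj g"
  by transfer (metis equivp_reflp equivp_heis_rel)

lemma nil_translate_proj: "nil_translate g (nil_proj h) = nil_proj (heis_mult g h)"
  by transfer (metis equivp_reflp equivp_heis_rel)

lemma heis_rel_iff: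
  "heis_rel (x, y, z) (x', y', z') \<longleftrightarrow>
     x' - x \<in> int_vectors \<and> y' - y \<in> int_vectors \<and> z' - z - x \<bullet> (y' - y) \<in> \<int>"
proof
  assume "heis_rel (x, y, z) (x', y', z')"
  then show "x' - x \<in> int_vectors \<and> y' - y \<in> int_vectors \<and> z' - z - x \<bullet> (y' - y) \<in> \<int>"
    by (auto simp: heis_rel_def heis_int_def heis_mult_def)
next
  assume "x' - x \<in> int_vectors \<and> y' - y \<in> int_vectors \<and> z' - z - x \<bullet> (y' - y) \<in> \<int>"
  then show "heis_rel (x, y, z) (x', y', z')"
    unfolding heis_rel_def
    by (intro bexI[of _ "(x' - x, y' - y, z' - z - x \<bullet> (y' - y))"])
      (auto simp: heis_int_def heis_mult_def)
qed

lemma nil_lift: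
  fixes f :: "'n::finite heis \<Rightarrow> 'b::topological_space"
  assumes f: "continuous_on UNIV f" and inv: "\<And>g h. heis_rel g h \<Longrightarrow> f g = f h"
  obtains H where "continuous_on UNIV H" "\<And>g. H (nil_proj g) = f g"
proof -
  define H where "H x = f (SOME g. x = nil_proj g)" for x
  have H: "H (nil_proj g) = f g" for g
  proof -
    have "nil_proj g = nil_proj (SOME h. nil_proj g = nil_proj h)"
      by (rule someI[of "\<lambda>h. nil_proj g = nil_proj h" g]) simp
    then have "heis_rel g (SOME h. nil_proj g = nil_proj h)"
      by (simp only: nil_proj_eq_iff)
    then show ?thesis
      unfolding H_def using inv by metis
  qed
  have "nil_proj -` H -` U = f -` U" for U
    by (auto simp: H)
  then have "continuous_on UNIV H"
    using f by (simp add: continuous_on_open_vimage open_nilmanifold_def)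
  then show ?thesis
    using H that by blast
qed

lemma continuous_heis_mult:
  "continuous_on UNIV (\<lambda>(g, h). heis_mult g (h :: 'n::finite heis))"
  unfolding heis_mult_def case_prod_beta by (intro continuous_intros)

lemma continuous_on_heis_mult [continuous_intros]:
  assumes "continuous_on S f" "continuous_on S g"
  shows "continuous_on S (\<lambda>x. heis_mult (f x) (g x))"
  using continuous_on_compose2[OF continuous_heis_mult continuous_on_Pair[OF assms]] by simp

lemma continuous_nil_translate: "continuous_on UNIV (nil_translate g)"
proof -
  have "nil_proj -` nil_translate g -` U = heis_mult g -` nil_proj -` U" for U
    by (auto simp: nil_translate_proj)
  moreover have "open (heis_mult g -` nil_proj -` U)" if "open U" for U
  proof (rule open_vimage)
    show "open (nil_proj -` U)"
      using that by (simp add: open_nilmanifold_def)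
  qed (intro continuous_intros)
  ultimately show ?thesis
    by (simp add: continuous_on_open_vimage open_nilmanifold_def)
qed

text \<open>A compact set that meets every coset, hence a substitute for the quotient in compactness
  arguments.\<close>

definition heis_unit_cube :: "'n::finite heis set" where
  "heis_unit_cube = cbox 0 1 \<times> cbox 0 1 \<times> {0..1}"

lemma compact_heis_unit_cube: "compact heis_unit_cube"
  unfolding heis_unit_cube_def by (intro compact_Times compact_cbox compact_Icc)

lemma nil_proj_unit_cube:
  obtains g where "g \<in> heis_unit_cube" "x = nil_proj g"
proof -
  obtain v w z where x: "x = nil_proj (v, w, z)"
    using surj_nil_proj[of x] by (metis prod_cases3)
  obtain k l where kl: "k \<in> int_vectors" "v + k \<in> cbox 0 1" "l \<in> int_vectors" "w + l \<in> cbox 0 1"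
    using int_vectors_translate_unit_cube by blast
  \<comment> \<open>Moving \<open>w\<close> by the integer vector \<open>l\<close> shifts the
    central coordinate by \<open>v \<bullet> l\<close>; only then can its integer part be
    removed.\<close>
  define z' where "z' = frac (z + v \<bullet> l)"
  have "z' - z - v \<bullet> l = - of_int \<lfloor>z + v \<bullet> l\<rfloor>"
    by (simp add: z'_def frac_def)
  then have "heis_rel (v, w, z) (v + k, w + l, z')"
    using kl by (simp add: heis_rel_iff)
  moreover have "(v + k, w + l, z') \<in> heis_unit_cube"
    using kl frac_lt_1[of "z + v \<bullet> l"] by (simp add: heis_unit_cube_def z'_def less_imp_le)
  ultimately show ?thesis
    using that by (simp add: x nil_proj_eq_iff)
qed

lemma compact_nilmanifold: "compact (UNIV :: 'n::finite nilmanifold set)"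
proof -
  have "UNIV = nil_proj ` (heis_unit_cube :: 'n heis set)"
    using nil_proj_unit_cube by blast
  then show ?thesis
    by (metis compact_heis_unit_cube compact_continuous_image
        continuous_on_subset[OF continuous_nil_proj] subset_UNIV)
qed

lemma bounded_on_nilmanifold:
  fixes H :: "'n::finite nilmanifold \<Rightarrow> complex"
  assumes "continuous_on UNIV H"
  obtains C where "C > 0" "\<And>x. norm (H x) \<le> C"
  using compact_imp_bounded[OF compact_continuous_image[OF assms compact_nilmanifold]]
  unfolding bounded_pos by auto

text \<open>Uniform continuity of \<open>H\<close> composed with the group product on the compact
  set \<open>cball g0 1 \<times> heis_unit_cube\<close>. The estimate is uniform in \<open>x\<close>
  because every point has a representative in the cube.\<close>

lemma nil_translate_equicontinuous:
  fixes H :: "'n::finite nilmanifold \<Rightarrow> complex"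
  assumes H: "continuous_on UNIV H" and e: "e > 0"
  shows "\<forall>\<^sub>F g in nhds g0. \<forall>x. norm (H (nil_translate g x) - H (nil_translate g0 x)) < e"
proof -
  have "continuous_on UNIV (\<lambda>p :: 'n heis \<times> 'n heis. heis_mult (fst p) (snd p))"
    by (intro continuous_intros)
  from continuous_on_compose2[OF H continuous_on_compose2[OF continuous_nil_proj this]]
  have "continuous_on UNIV (\<lambda>p. H (nil_proj (heis_mult (fst p) (snd p))))"
    by simp
  then have "uniformly_continuous_on (cball g0 1 \<times> heis_unit_cube)
      (\<lambda>p. H (nil_proj (heis_mult (fst p) (snd p))))"
    by (intro compact_uniformly_continuous compact_Times compact_cball compact_heis_unit_cube)
      (rule continuous_on_subset, auto)
  then obtain d where d: "d > 0" and
    close: "\<And>p q. p \<in> cball g0 1 \<times> heis_unit_cube \<Longrightarrow> q \<in> cball g0 1 \<times> heis_unit_cube \<Longrightarrow>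
      dist q p < d \<Longrightarrow> dist (H (nil_proj (heis_mult (fst q) (snd q))))
        (H (nil_proj (heis_mult (fst p) (snd p)))) < e"
    using e unfolding uniformly_continuous_on_def by metis
  have "\<forall>x. norm (H (nil_translate g x) - H (nil_translate g0 x)) < e"
    if g: "dist g g0 < min d 1" for g
  proof
    fix x :: "'n nilmanifold"
    obtain h where h: "h \<in> heis_unit_cube" and x: "x = nil_proj h"
      by (rule nil_proj_unit_cube)
    have "dist (g, h) (g0, h) < d"
      using g by (simp add: dist_Pair_Pair)
    then have "dist (H (nil_proj (heis_mult g h))) (H (nil_proj (heis_mult g0 h))) < e"
      using close[of "(g0, h)" "(g, h)"] h g by (simp add: dist_commute)
    then show "norm (H (nil_translate g x) - H (nil_translate g0 x)) < e"
      by (simp add: x nil_translate_proj dist_norm)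
  qed
  then show ?thesis
    unfolding eventually_nhds_metric using d by (intro exI[of _ "min d 1"]) auto
qed

section \<open>The projection to the horizontal torus\<close>

lift_definition nil_horizontal :: "'n::finite nilmanifold \<Rightarrow> 'n horizontal_torus" is horizontal
  by (auto simp: horizontal_def torus_rel_def heis_rel_iff split: prod.splits)

lemma nil_horizontal_proj: "nil_horizontal (nil_proj g) = torus_proj (horizontal g)"
  by transfer (metis equivp_reflp equivp_torus_rel)

lemma continuous_nil_horizontal:
  "continuous_on UNIV (nil_horizontal :: 'n::finite nilmanifold \<Rightarrow> _)"
proof -
  have "nil_proj -` nil_horizontal -` U = horizontal -` torus_proj -` U"
    for U :: "'n horizontal_torus set"
    by (auto simp: nil_horizontal_proj)
  moreover have "open (horizontal -` torus_proj -` U)" if "open U" for U :: "'n horizontal_torus set"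
  proof (rule open_vimage)
    show "open (torus_proj -` U)"
      using that by (simp add: open_horizontal_torus_def)
    show "continuous_on UNIV horizontal"
      unfolding horizontal_def case_prod_beta by (intro continuous_intros)
  qed
  ultimately show ?thesis
    by (simp add: continuous_on_open_vimage open_nilmanifold_def open_horizontal_torus_def)
qed

text \<open>The push-forward of \<open>m\<close> is invariant under torus translations, and
  invariant measures on the torus agree on continuous functions.\<close>

lemma integral_nil_horizontal:
  fixes m :: "'n::finite nilmanifold measure" and f :: "'n horizontal_torus \<Rightarrow> real"
  assumes m: "invariant_prob_measure nil_translate m"
    and h: "invariant_prob_measure torus_translate h" and f: "continuous_on UNIV f"
  shows "(\<integral>x. f (nil_horizontal x) \<partial>m) = (\<integral>x. f x \<partial>h)"
proof -
  note prob = invariant_prob_measureD[OF m]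
  have hor: "nil_horizontal \<in> borel_measurable m"
    using borel_measurable_continuous_onI[OF continuous_nil_horizontal] prob(2)
      measurable_cong_sets by blast
  have trans: "nil_translate g \<in> m \<rightarrow>\<^sub>M m" for g
    using borel_measurable_continuous_onI[OF continuous_nil_translate] prob(2)
      measurable_cong_sets by blast
  have "distr (distr m borel nil_horizontal) borel (torus_translate (v, w)) =
      distr m borel nil_horizontal" for v w
  proof -
    \<comment> \<open>Each torus translation lifts to a nilmanifold translation, so invariance of
      \<open>m\<close> passes to the push-forward.\<close>
    have comm: "torus_translate (v, w) \<circ> nil_horizontal = nil_horizontal \<circ> nil_translate (v, w, 0)"
    proof
      fix x :: "'n nilmanifold"
      obtain g where "x = nil_proj g"
        using surj_nil_proj by blast
      then show "(torus_translate (v, w) \<circ> nil_horizontal) x =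
          (nil_horizontal \<circ> nil_translate (v, w, 0)) x"
        by (cases g) (simp add: nil_horizontal_proj torus_translate_proj nil_translate_proj
            horizontal_def heis_mult_def)
    qed
    have "distr (distr m borel nil_horizontal) borel (torus_translate (v, w)) =
        distr m borel (torus_translate (v, w) \<circ> nil_horizontal)"
      by (rule distr_distr[OF borel_measurable_continuous_onI[OF continuous_torus_translate] hor])
    also have "\<dots> = distr (distr m m (nil_translate (v, w, 0))) borel nil_horizontal"
      unfolding comm by (rule distr_distr[OF hor trans, symmetric])
    also have "distr m m (nil_translate (v, w, 0)) = distr m borel (nil_translate (v, w, 0))"
      using prob(2) by (intro distr_cong) auto
    also have "\<dots> = m"
      using m by (simp add: invariant_prob_measure_def)
    finally show ?thesis .
  qed
  then have "invariant_prob_measure torus_translate (distr m borel nil_horizontal)"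
    using prob_space.prob_space_distr[OF prob(1) hor] by (auto simp: invariant_prob_measure_def)
  from torus_invariant_measure_unique[OF h this f] show ?thesis
    using hor borel_measurable_continuous_onI[OF f] by (simp add: integral_distr)
qed

section \<open>Vertical characters and their density\<close>

text \<open>The fibres of \<open>nil_horizontal\<close> are circles, the orbits of the centre; on
  each of them \<open>H\<close> is a multiple of the Fourier mode of frequency
  \<open>m\<close>.\<close>

definition vertical_char :: "int \<Rightarrow> ('n::finite nilmanifold \<Rightarrow> complex) \<Rightarrow> bool" where
  "vertical_char m H \<longleftrightarrow> continuous_on UNIV H \<and>
     (\<forall>w x. H (nil_translate (0, 0, w) x) = ei (of_int m * w) * H x)"

definition vertical_chars :: "('n::finite nilmanifold \<Rightarrow> complex) set" where
  "vertical_chars = {H. \<exists>m. vertical_char m H}"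

lemma vertical_charD:
  assumes "vertical_char m H"
  shows "continuous_on UNIV H" "H (nil_translate (0, 0, w) x) = ei (of_int m * w) * H x"
  using assms by (simp_all add: vertical_char_def)

lemma continuous_vertical_chars: "H \<in> vertical_chars \<Longrightarrow> continuous_on UNIV H"
  by (auto simp: vertical_chars_def vertical_charD)

lemma vertical_char_mult:
  assumes "vertical_char m H" "vertical_char l K"
  shows "vertical_char (m + l) (\<lambda>x. H x * K x)"
  using assms by (auto simp: vertical_char_def distrib_right ei_add intro!: continuous_intros)

lemma vertical_char_cnj: "vertical_char m H \<Longrightarrow> vertical_char (- m) (\<lambda>x. cnj (H x))"
  by (auto simp: vertical_char_def cnj_ei intro!: continuous_intros)

lemma nil_translate_translate: "nil_translate g (nil_translate h x) = nil_translate (heis_mult g h) x"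
  by (metis surj_nil_proj nil_translate_proj heis.assoc)

lemma nil_translate_one [simp]: "nil_translate heis_one x = x"
  by (metis surj_nil_proj nil_translate_proj heis.left_neutral)

lemma nil_translate_center:
  "nil_translate g (nil_translate (0, 0, w) x) = nil_translate (0, 0, w) (nil_translate g x)"
  by (cases g) (simp add: nil_translate_translate heis_mult_def add.commute)

text \<open>Away from half-integers \<open>round u\<close> is locally constant and the formula is
  continuous as it stands. At a half-integer the cosine vanishes, and since the other factor has
  modulus one the product tends to zero there despite the jump.\<close>

lemma continuous_periodic_factor:
  "continuous_on UNIV (\<lambda>(x, u). of_real \<bar>cos (pi * u)\<bar> * ei (- x * of_int (round u)))"
    (is "continuous_on UNIV ?f")
proof -
  have "(?f \<longlongrightarrow> ?f (x, u)) (nhds (x, u))" for x u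
  proof (cases "\<bar>u - of_int (round u)\<bar> < 1/2")
    case True
    have "((\<lambda>p. \<bar>snd p - of_int (round u)\<bar>) \<longlongrightarrow> \<bar>u - of_int (round u)\<bar>) (nhds (x, u))"
      by (auto intro!: tendsto_eq_intros tendsto_snd filterlim_ident)
    from order_tendstoD(2)[OF this True]
    have ev: "\<forall>\<^sub>F p in nhds (x, u). of_real \<bar>cos (pi * snd p)\<bar> * ei (- fst p * of_int (round u)) = ?f p"
    proof eventually_elim
      case (elim p)
      then have "round (snd p) = round u"
        by (rule round_unique')
      then show ?case by (simp add: case_prod_beta)
    qed
    have "isCont (\<lambda>p. of_real \<bar>cos (pi * snd p)\<bar> * ei (- fst p * of_int (round u))) (x, u)"
    proof -
      have "continuous_on UNIV (\<lambda>p::real\<times>real. of_real \<bar>cos (pi * snd p)\<bar> * ei (- fst p * of_int (round u)))"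
        by (intro continuous_intros)
      then show ?thesis
        by (simp add: continuous_on_eq_continuous_at)
    qed
    then have "((\<lambda>p. of_real \<bar>cos (pi * snd p)\<bar> * ei (- fst p * of_int (round u))) \<longlongrightarrow> ?f (x, u))
        (nhds (x, u))"
      unfolding isCont_def by (subst tendsto_nhds_iff) simp
    then show ?thesis
      using tendsto_cong[OF ev] by simp
  next
    case False
    then have "\<bar>u - of_int (round u)\<bar> = 1/2"
      using of_int_round_abs_le[of u] by linarith
    then have "u = of_int (round u) + 1/2 \<or> u = of_int (round u - 1) + 1/2"
      by (auto simp: abs_if split: if_splits)
    then obtain k :: int where "u = of_int k + 1/2"
      by blast
    then have "pi * u = of_int k * pi + pi / 2"
      by (simp add: distrib_left)
    then have 0: "cos (pi * u) = 0"
      unfolding cos_zero_iff_int2 by blast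
    have "((\<lambda>p. \<bar>cos (pi * snd p)\<bar>) \<longlongrightarrow> \<bar>cos (pi * u)\<bar>) (nhds (x, u))"
      by (auto intro!: tendsto_eq_intros tendsto_snd filterlim_ident)
    then have "((\<lambda>p. norm (?f p)) \<longlongrightarrow> 0) (nhds (x, u))"
      by (simp add: 0 norm_mult case_prod_beta)
    then show ?thesis
      using 0 by (simp add: tendsto_norm_zero_iff)
  qed
  then show ?thesis
    by (auto simp: continuous_on_def intro!: tendsto_mono[OF at_within_le_nhds])
qed

text \<open>
  A theta-like function, obtained by making a bump function in \<open>y\<close> quasi-periodic; the bump
  \<open>\<bar>cos (\<pi> u)\<bar>\<close> vanishes exactly where \<open>round u\<close> jumps.
\<close>

lemma vertical_char_nonvanishing:
  fixes x0 y0 :: "real ^ 'n::finite"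
  obtains H where "vertical_char 1 H" "H (nil_proj (x0, y0, z0)) \<noteq> 0"
proof -
  define f :: "'n heis \<Rightarrow> complex" where
    "f = (\<lambda>(x, y, z). ei z * (\<Prod>i\<in>UNIV. of_real \<bar>cos (pi * (y $ i - y0 $ i))\<bar> *
      ei (- x $ i * of_int (round (y $ i - y0 $ i)))))"
  have "continuous_on UNIV f"
  proof -
    have "continuous_on UNIV (\<lambda>g :: 'n heis. of_real \<bar>cos (pi * (fst (snd g) $ i - y0 $ i))\<bar> *
        ei (- fst g $ i * of_int (round (fst (snd g) $ i - y0 $ i))))" for i
    proof -
      have "continuous_on UNIV (\<lambda>g :: 'n heis. (fst g $ i, fst (snd g) $ i - y0 $ i))"
        by (intro continuous_intros)
      from continuous_on_compose2[OF continuous_periodic_factor this] show ?thesis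
        by simp
    qed
    from this have "continuous_on UNIV (\<lambda>g :: 'n heis. \<Prod>i\<in>UNIV. of_real \<bar>cos (pi * (fst (snd g) $ i - y0 $ i))\<bar> *
        ei (- fst g $ i * of_int (round (fst (snd g) $ i - y0 $ i))))"
      by (rule continuous_on_prod)
    moreover have "continuous_on UNIV (\<lambda>g :: 'n heis. ei (snd (snd g)))"
      by (intro continuous_intros)
    ultimately show ?thesis
      unfolding f_def case_prod_beta by (rule continuous_on_mult[rotated])
  qed
  moreover have "f g = f g'" if "heis_rel g g'" for g g'
  proof -
    obtain x y z x' y' z' where g: "g = (x, y, z)" "g' = (x', y', z')"
      by (metis prod_cases3)
    have rel: "x' - x \<in> int_vectors" "y' - y \<in> int_vectors" "z' - z - x \<bullet> (y' - y) \<in> \<int>"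
      using that by (auto simp: g heis_rel_iff)
    \<comment> \<open>Passing to another representative of the coset moves coordinate
      \<open>i\<close> of \<open>x\<close> by an integer \<open>k\<close> and that of
      \<open>y\<close> by an integer \<open>l\<close>. The bump is unchanged, \<open>round\<close>
      moves by \<open>l\<close>, and the contribution of \<open>k\<close> is an integer that
      \<open>ei\<close> ignores.\<close>
    have factor: "of_real \<bar>cos (pi * (y' $ i - y0 $ i))\<bar> *
        ei (- x' $ i * of_int (round (y' $ i - y0 $ i))) =
      of_real \<bar>cos (pi * (y $ i - y0 $ i))\<bar> * ei (- x $ i * of_int (round (y $ i - y0 $ i))) *
        ei (- (x $ i * (y' $ i - y $ i)))" for i
    proof -
      obtain k where k: "x' $ i = x $ i + of_int k"
        using rel(1) by (auto simp: int_vectors_def elim!: allE[of _ i] Ints_cases)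
          (metis add.commute diff_add_cancel)
      obtain l where l: "y' $ i = y $ i + of_int l"
        using rel(2) by (auto simp: int_vectors_def elim!: allE[of _ i] Ints_cases)
          (metis add.commute diff_add_cancel)
      define u where "u = y $ i - y0 $ i"
      have u': "y' $ i - y0 $ i = u + of_int l"
        by (simp add: u_def l)
      have rnd: "round (u + of_int l) = round u + l"
        by (simp add: round_def add.assoc[symmetric] add.commute[of _ "1/2"])
      have sin: "sin (pi * of_int l) = 0"
        unfolding sin_zero_iff_int2 by (auto intro: exI[of _ l])
      then have "\<bar>cos (pi * of_int l)\<bar> = 1"
        using sin_cos_squared_add[of "pi * of_int l"] by (simp add: abs_square_eq_1)
      then have "\<bar>cos (pi * (u + of_int l))\<bar> = \<bar>cos (pi * u)\<bar>"
        by (simp add: distrib_left cos_add sin abs_mult)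
      moreover have "ei (- x' $ i * of_int (round (u + of_int l))) =
          ei (- x $ i * of_int (round u)) * ei (- (x $ i * of_int l))"
      proof -
        have "- x' $ i * of_int (round (u + of_int l)) =
            (- x $ i * of_int (round u) + - (x $ i * of_int l)) + - of_int (k * (round u + l))"
          by (simp add: k rnd algebra_simps)
        moreover have "ei (- of_int (k * (round u + l))) = 1"
          unfolding ei_eq_1_iff by simp
        ultimately show ?thesis
          by (simp only: ei_add mult_1_right)
      qed
      ultimately show ?thesis
        unfolding u' by (simp add: l u_def mult.assoc)
    qed
    \<comment> \<open>The factors left over in the single coordinates combine to one phase, which
      the change of the central coordinate within a coset cancels.\<close>
    have prod_ei: "(\<Prod>i\<in>UNIV. ei (- (x $ i * (y' $ i - y $ i)))) = ei (- (x \<bullet> (y' - y)))"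
    proof -
      have "(\<Prod>i\<in>A. ei (r i)) = ei (\<Sum>i\<in>A. r i)" if "finite A" for A :: "'n set" and r
        using that by induction (simp_all add: ei_add)
      from this[of UNIV "\<lambda>i. - (x $ i * (y' $ i - y $ i))"] show ?thesis
        by (simp add: inner_vec_def sum_negf)
    qed
    have "f g' = ei z' * ei (- (x \<bullet> (y' - y))) *
        (\<Prod>i\<in>UNIV. of_real \<bar>cos (pi * (y $ i - y0 $ i))\<bar> *
          ei (- x $ i * of_int (round (y $ i - y0 $ i))))"
      unfolding f_def g case_prod_conv factor by (simp only: prod.distrib prod_ei mult_ac)
    moreover have "ei z' * ei (- (x \<bullet> (y' - y))) = ei z"
    proof -
      have "z' + - (x \<bullet> (y' - y)) = z + (z' - z - x \<bullet> (y' - y))"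
        by simp
      moreover have "ei (z' - z - x \<bullet> (y' - y)) = 1"
        using rel(3) by (simp only: ei_eq_1_iff)
      ultimately show ?thesis
        by (metis ei_add mult_1_right)
    qed
    ultimately show ?thesis
      by (simp add: f_def g)
  qed
  ultimately obtain H where H: "continuous_on UNIV H" "\<And>g. H (nil_proj g) = f g"
    using nil_lift[of f] by blast
  have "H (nil_translate (0, 0, w) x) = ei w * H x" for w x
  proof -
    obtain v u z where "x = nil_proj (v, u, z)"
      using surj_nil_proj[of x] by (metis prod_cases3)
    then show ?thesis
      by (simp add: nil_translate_proj H heis_mult_def f_def ei_add)
  qed
  then have "vertical_char 1 H"
    using H by (simp add: vertical_char_def)
  moreover have "H (nil_proj (x0, y0, z0)) \<noteq> 0"
  proof -
    \<comment> \<open>The bumps are centred at \<open>y0\<close>: each cosine is taken at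
      \<open>0\<close> and each rounded value is \<open>0\<close>.\<close>
    have "norm (H (nil_proj (x0, y0, z0))) = 1"
      by (simp add: H f_def norm_mult)
    then show ?thesis by auto
  qed
  ultimately show ?thesis
    using that by blast
qed

text \<open>Points over different torus points are separated by a lifted torus character. Points in
  one fibre differ by a central translation with \<open>r \<notin> \<int>\<close>, which a frequency
  one character not vanishing there detects.\<close>

lemma vertical_chars_separate:
  fixes x y :: "'n::finite nilmanifold"
  assumes "x \<noteq> y"
  shows "\<exists>H\<in>vertical_chars. H x \<noteq> H y"
proof (cases "nil_horizontal x = nil_horizontal y")
  case False
  then obtain K where K: "K \<in> torus_chars" "K (nil_horizontal x) \<noteq> K (nil_horizontal y)"
    using torus_chars_separate by blast
  have "nil_horizontal (nil_translate (0, 0, w) z) = nil_horizontal z"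
    for w and z :: "'n nilmanifold"
  proof -
    obtain g where "z = nil_proj g"
      using surj_nil_proj by blast
    then show ?thesis
      by (cases g) (simp add: nil_translate_proj nil_horizontal_proj horizontal_def heis_mult_def)
  qed
  moreover have "continuous_on UNIV (\<lambda>z. K (nil_horizontal z))"
    by (rule continuous_on_compose2[OF continuous_torus_chars[OF K(1)] continuous_nil_horizontal]) simp
  ultimately have "vertical_char 0 (\<lambda>z. K (nil_horizontal z))"
    by (simp add: vertical_char_def)
  then show ?thesis
    using K(2) by (auto simp: vertical_chars_def)
next
  case True
  obtain g g' where xy: "x = nil_proj g" "y = nil_proj g'"
    using surj_nil_proj by blast
  obtain v w z where g: "g = (v, w, z)"
    by (metis prod_cases3)
  obtain v' w' z' where g': "g' = (v', w', z')"
    by (metis prod_cases3)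
  define r where "r = z' - z - v \<bullet> (w' - w)"
  have int: "v' - v \<in> int_vectors" "w' - w \<in> int_vectors"
    using True by (auto simp: xy g g' nil_horizontal_proj horizontal_def torus_proj_eq_iff torus_rel_def)
  then have "nil_translate (0, 0, r) x = y"
    by (simp add: xy g g' nil_translate_proj heis_mult_def nil_proj_eq_iff heis_rel_iff r_def)
  then have y: "y = nil_translate (0, 0, r) x" ..
  obtain H where H: "vertical_char 1 H" "H x \<noteq> 0"
    unfolding xy g by (rule vertical_char_nonvanishing)
  have "r \<notin> \<int>"
    using assms int by (auto simp: xy g g' nil_proj_eq_iff heis_rel_iff r_def)
  then have "H y \<noteq> H x"
    using H by (simp add: y vertical_charD(2)[OF H(1)] ei_eq_1_iff)
  then show ?thesis
    using H(1) by (metis (mono_tags, lifting) mem_Collect_eq vertical_chars_def)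
qed

instance nilmanifold :: (finite) t2_space
proof
  fix x y :: "'a nilmanifold"
  assume "x \<noteq> y"
  then show "\<exists>U V. open U \<and> open V \<and> x \<in> U \<and> y \<in> V \<and> U \<inter> V = {}"
    by (meson vertical_chars_separate continuous_vertical_chars hausdorff_if_separated)
qed

lemma vertical_chars_dense:
  fixes f :: "'n::finite nilmanifold \<Rightarrow> real"
  assumes "continuous_on UNIV f" and "e > 0"
  shows "\<exists>g\<in>re_sums vertical_chars. \<forall>x. \<bar>f x - g x\<bar> < e"
proof (rule re_sums_dense[OF compact_nilmanifold continuous_vertical_chars _ _ _
      vertical_chars_separate assms])
  show "(\<lambda>x. H x * K x) \<in> vertical_chars"
    if "H \<in> vertical_chars" "K \<in> vertical_chars" for H K :: "'n nilmanifold \<Rightarrow> complex"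
    using that vertical_char_mult unfolding vertical_chars_def by blast
  show "(\<lambda>x. cnj (H x)) \<in> vertical_chars"
    if "H \<in> vertical_chars" for H :: "'n nilmanifold \<Rightarrow> complex"
    using that vertical_char_cnj unfolding vertical_chars_def by blast
  have "vertical_char 0 (\<lambda>x :: 'n nilmanifold. c)" for c
    by (simp add: vertical_char_def)
  then show "(\<lambda>x :: 'n nilmanifold. c) \<in> vertical_chars" for c
    unfolding vertical_chars_def by auto
qed

section \<open>Integrals of rapidly varying functions\<close>

lemma norm_integral_le:
  fixes f :: "real \<Rightarrow> 'a::banach"
  assumes "continuous_on UNIV f" and "\<And>t. norm (f t) \<le> C" and "u \<le> v"
  shows "norm (integral {u..v} f) \<le> C * (v - u)"
  using assms by (intro integral_bound continuous_on_subset[OF assms(1)]) auto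

text \<open>Local bounds proportional to the length add up over a subdivision. Near the finitely
  many points of \<open>B\<close> no local information is available, but the uniform bound
  \<open>C\<close> makes short intervals around them negligible.\<close>

lemma integral_tendsto_zero_locally:
  fixes F :: "'i \<Rightarrow> real \<Rightarrow> 'a::banach"
  assumes cont: "\<And>s. continuous_on UNIV (F s)" and bound: "\<And>s t. norm (F s t) \<le> C"
    and B: "finite B"
    and local: "\<And>x \<epsilon>. x \<notin> B \<Longrightarrow> \<epsilon> > 0 \<Longrightarrow> \<exists>d>0. \<forall>u v. u \<le> x \<and> x \<le> v \<and> v - u < d \<longrightarrow>
      (\<forall>\<^sub>F s in G. norm (integral {u..v} (F s)) \<le> \<epsilon> * (v - u))"
    and ab: "a \<le> b"
  shows "((\<lambda>s. integral {a..b} (F s)) \<longlongrightarrow> 0) G"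
proof -
  have split: "integral {u..w} (F s) = integral {u..v} (F s) + integral {v..w} (F s)"
    if "u \<le> v" "v \<le> w" for u v w s
    by (rule Henstock_Kurzweil_Integration.integral_combine[OF that
          integrable_continuous_interval[OF continuous_on_subset[OF cont]], symmetric]) simp
  have C: "C \<ge> 0"
    using bound[of undefined undefined] norm_ge_zero order_trans by blast
  have closed: "((\<lambda>s. integral {a..b} (F s)) \<longlongrightarrow> 0) G" if ab: "a \<le> b" "{a..b} \<inter> B = {}" for a b
  proof (rule tendsto_norm_zero_cancel, rule tendstoI)
    fix e :: real assume e: "e > 0"
    define \<epsilon> where "\<epsilon> = e / (2 * (b - a + 1))"
    have \<epsilon>: "\<epsilon> > 0" using e ab by (simp add: \<epsilon>_def)
    \<comment> \<open>A bound proportional to the length is stable under joining adjacent intervals,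
      so Bolzano's bisection spreads it from small intervals to the whole one.\<close>
    have "\<forall>\<^sub>F s in G. norm (integral {a..b} (F s)) \<le> \<epsilon> * (b - a)"
      using ab(1)
    proof (induction rule: Bolzano)
      case (trans u v w)
      from trans(1,2) show ?case
      proof eventually_elim
        case (elim s)
        then show ?case
          unfolding split[OF trans(3,4)]
          by (smt (verit) norm_triangle_ineq distrib_left right_diff_distrib)
      qed
    next
      case (local x)
      then have "x \<notin> B" using ab by auto
      from assms(4)[OF this \<epsilon>] show ?case by blast
    qed
    moreover have "\<epsilon> * (b - a) < e"
    proof -
      have "\<epsilon> * (b - a) \<le> \<epsilon> * (b - a + 1)"
        using \<epsilon> by simp
      also have "\<dots> = e / 2"
      proof -
        have "b - a + 1 \<noteq> 0" using ab by simp
        then show ?thesis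
          unfolding \<epsilon>_def by (metis nonzero_mult_divide_mult_cancel_right times_divide_eq_left)
      qed
      finally show ?thesis using e by simp
    qed
    ultimately show "\<forall>\<^sub>F s in G. dist (norm (integral {a..b} (F s))) 0 < e"
      by (auto elim!: eventually_mono)
  qed
  have "open": "((\<lambda>s. integral {a..b} (F s)) \<longlongrightarrow> 0) G"
    if ab: "a \<le> b" "{a<..<b} \<inter> B = {}" for a b
  proof (cases "a = b")
    case True
    then show ?thesis by simp
  next
    case False
    show ?thesis
    proof (rule tendsto_norm_zero_cancel, rule tendstoI)
      fix e :: real assume e: "e > 0"
      \<comment> \<open>The two end pieces of length \<open>\<eta>\<close> cost at most
        \<open>e / 4\<close> each, and the closed middle piece, free of points of \<open>B\<close>,
        is eventually below \<open>e / 2\<close>.\<close>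
      define \<eta> where "\<eta> = min ((b - a) / 2) (e / (4 * (C + 1)))"
      have \<eta>: "\<eta> > 0" "a + \<eta> \<le> b - \<eta>"
        using e C False ab by (auto simp: \<eta>_def min_def field_simps)
      have "C * \<eta> \<le> (C + 1) * \<eta>"
        using \<eta> by simp
      also have "\<dots> \<le> (C + 1) * (e / (4 * (C + 1)))"
        using C by (intro mult_left_mono) (auto simp: \<eta>_def)
      also have "\<dots> = e / 4"
      proof -
        have "K * (e / (4 * K)) = e / 4" if "K > 0" for K
          using that by simp
        from this[of "C + 1"] show ?thesis using C by fastforce
      qed
      finally have C\<eta>: "C * \<eta> \<le> e / 4" .
      have edges: "norm (integral {a..a + \<eta>} (F s)) \<le> C * \<eta>"
        "norm (integral {b - \<eta>..b} (F s)) \<le> C * \<eta>" for s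
        using norm_integral_le[OF cont bound, of a "a + \<eta>" s]
          norm_integral_le[OF cont bound, of "b - \<eta>" b s] \<eta> by auto
      have "((\<lambda>s. norm (integral {a + \<eta>..b - \<eta>} (F s))) \<longlongrightarrow> 0) G"
      proof (rule tendsto_norm_zero, rule closed)
        have "{a + \<eta>..b - \<eta>} \<subseteq> {a<..<b}"
          using \<eta> by auto
        then show "{a + \<eta>..b - \<eta>} \<inter> B = {}"
          using ab by blast
      qed (fact \<eta>(2))
      from order_tendstoD(2)[OF this half_gt_zero[OF e]]
      have "\<forall>\<^sub>F s in G. norm (integral {a..b} (F s)) < e"
      proof eventually_elim
        case (elim s)
        have "integral {a..b} (F s) = integral {a..a + \<eta>} (F s) +
            (integral {a + \<eta>..b - \<eta>} (F s) + integral {b - \<eta>..b} (F s))"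
          using split[of a "a + \<eta>" b s] split[of "a + \<eta>" "b - \<eta>" b s] \<eta> by simp
        then have "norm (integral {a..b} (F s)) \<le> norm (integral {a..a + \<eta>} (F s)) +
            (norm (integral {a + \<eta>..b - \<eta>} (F s)) + norm (integral {b - \<eta>..b} (F s)))"
          using norm_triangle_ineq[of "integral {a..a + \<eta>} (F s)"
              "integral {a + \<eta>..b - \<eta>} (F s) + integral {b - \<eta>..b} (F s)"]
            norm_triangle_ineq[of "integral {a + \<eta>..b - \<eta>} (F s)" "integral {b - \<eta>..b} (F s)"]
          by (simp only:)
        then show ?case
          using elim edges[of s] C\<eta> by linarith
      qed
      then show "\<forall>\<^sub>F s in G. dist (norm (integral {a..b} (F s))) 0 < e"
        by simp
    qed
  qed
  \<comment> \<open>Bisection again, now for convergence itself: a short interval around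
    \<open>x\<close> contains no point of \<open>B\<close> other than possibly \<open>x\<close>,
    where it is cut in two.\<close>
  show ?thesis
    using ab
  proof (induction rule: Bolzano)
    case (trans u v w)
    then show ?case
      unfolding split[OF trans(3,4)] using tendsto_add_zero by blast
  next
    case (local x)
    obtain d where d: "d > 0" "\<And>y. y \<in> B \<Longrightarrow> y \<noteq> x \<Longrightarrow> d \<le> dist x y"
      using finite_set_avoid[OF B, of x] by blast
    have "((\<lambda>s. integral {u..v} (F s)) \<longlongrightarrow> 0) G" if uv: "u \<le> x" "x \<le> v" "v - u < d" for u v
    proof -
      have "y \<notin> B" if "y \<in> {u<..<x} \<or> y \<in> {x<..<v}" for y
        using d(2)[of y] that uv by (auto simp: dist_real_def)
      then have "{u<..<x} \<inter> B = {}" "{x<..<v} \<inter> B = {}"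
        by blast+
      then show ?thesis
        unfolding split[OF uv(1,2)] using uv by (intro tendsto_add_zero "open")
    qed
    then show ?case using d(1) by blast
  qed
qed

text \<open>Shifting the window of integration changes the integral only by two end pieces of length
  \<open>\<bar>\<eta>\<bar>\<close>. A negative shift reduces to a positive one applied to the
  shifted function.\<close>

lemma norm_integral_shift_diff_le:
  fixes F :: "real \<Rightarrow> 'a::banach"
  assumes cont: "continuous_on UNIV F" and bound: "\<And>t. norm (F t) \<le> C" and uv: "u \<le> v"
  shows "norm (integral {u..v} (\<lambda>t. F (t + \<eta>)) - integral {u..v} F) \<le> 2 * C * \<bar>\<eta>\<bar>"
proof -
  have pos: "norm (integral {u..v} (\<lambda>t. F (t + \<eta>)) - integral {u..v} F) \<le> 2 * C * \<eta>"
    if cont: "continuous_on UNIV F" and bound: "\<And>t. norm (F t) \<le> C" and \<eta>: "\<eta> \<ge> 0"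
    for F :: "real \<Rightarrow> 'a" and \<eta>
  proof -
    have int: "F integrable_on {x..y}" for x y
      by (rule integrable_continuous_interval[OF continuous_on_subset[OF cont]]) simp
    have "integral {u..v} (\<lambda>t. F (t + \<eta>)) = integral {u + \<eta>..v + \<eta>} F"
      using integral_shift_real_ivl[of "u + \<eta>" \<eta> "v + \<eta>" F] by simp
    moreover have "integral {u..u + \<eta>} F + integral {u + \<eta>..v + \<eta>} F =
        integral {u..v} F + integral {v..v + \<eta>} F"
      using Henstock_Kurzweil_Integration.integral_combine[OF _ _ int, of u "u + \<eta>" "v + \<eta>"]
        Henstock_Kurzweil_Integration.integral_combine[OF _ _ int, of u v "v + \<eta>"] uv \<eta> by simp
    ultimately have "integral {u..v} (\<lambda>t. F (t + \<eta>)) - integral {u..v} F =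
        integral {v..v + \<eta>} F - integral {u..u + \<eta>} F"
      by (simp add: algebra_simps)
    moreover have "norm (integral {v..v + \<eta>} F) \<le> C * \<eta>" "norm (integral {u..u + \<eta>} F) \<le> C * \<eta>"
      using norm_integral_le[OF cont bound, of v "v + \<eta>"]
        norm_integral_le[OF cont bound, of u "u + \<eta>"] \<eta> by auto
    ultimately show ?thesis
      using norm_triangle_ineq4[of "integral {v..v + \<eta>} F" "integral {u..u + \<eta>} F"]
      by (simp add: mult.assoc)
  qed
  show ?thesis
  proof (cases "\<eta> \<ge> 0")
    case True
    then show ?thesis using pos[OF cont bound True] by simp
  next
    case False
    have "continuous_on UNIV (\<lambda>t. F (t + \<eta>))"
      by (rule continuous_on_compose2[OF cont]) (auto intro!: continuous_intros)
    from pos[OF this bound, of "- \<eta>"] show ?thesis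
      using False by (simp add: norm_minus_commute)
  qed
qed

text \<open>Replacing \<open>F s\<close> by the average of its shifts costs at most the largest
  \<open>2 * C * \<bar>\<eta> j s\<bar>\<close>, which vanishes in the limit. So only the function
  \<open>A s\<close> that approximates the average, locally uniformly near \<open>x\<close> for
  large \<open>s\<close>, matters.\<close>

lemma integral_shift_average:
  fixes F A :: "real \<Rightarrow> real \<Rightarrow> complex" and \<eta> :: "nat \<Rightarrow> real \<Rightarrow> real"
  assumes contF: "\<And>s. continuous_on UNIV (F s)" and bound: "\<And>s t. norm (F s t) \<le> C"
    and contA: "\<And>s. continuous_on UNIV (A s)" and n: "n > 0"
    and \<eta>: "\<And>j. j < n \<Longrightarrow> (\<eta> j \<longlongrightarrow> 0) at_top"
    and close: "\<And>e. e > 0 \<Longrightarrow> \<forall>\<^sub>F p in nhds x \<times>\<^sub>F at_top.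
      norm ((\<Sum>j<n. F (snd p) (fst p + \<eta> j (snd p))) / of_nat n - A (snd p) (fst p)) \<le> e"
    and \<epsilon>: "\<epsilon> > 0"
  shows "\<exists>d>0. \<forall>u v. u \<le> x \<and> x \<le> v \<and> v - u < d \<longrightarrow>
    (\<forall>\<^sub>F s in at_top. norm (integral {u..v} (F s) - integral {u..v} (A s)) \<le> \<epsilon> * (v - u))"
proof -
  have C: "C \<ge> 0"
    using bound[of undefined undefined] norm_ge_zero order_trans by blast
  define D where "D s t = (\<Sum>j<n. F s (t + \<eta> j s)) / of_nat n - A s t" for s t
  have "\<forall>\<^sub>F p in nhds x \<times>\<^sub>F at_top. norm (D (snd p) (fst p)) \<le> \<epsilon> / 2"
    using close[of "\<epsilon> / 2"] \<epsilon> by (simp add: D_def)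
  then obtain P Q where P: "eventually P (nhds x)" and Q: "eventually Q at_top"
    and PQ: "\<And>t s. P t \<Longrightarrow> Q s \<Longrightarrow> norm (D s t) \<le> \<epsilon> / 2"
    unfolding eventually_prod_filter by auto
  obtain d where d: "d > 0" "\<And>t. dist t x < d \<Longrightarrow> P t"
    using P unfolding eventually_nhds_metric by blast
  have "\<forall>\<^sub>F s in at_top. norm (integral {u..v} (F s) - integral {u..v} (A s)) \<le> \<epsilon> * (v - u)"
    if uv: "u \<le> x" "x \<le> v" "v - u < d" for u v
  proof (cases "u = v")
    case True
    then show ?thesis by simp
  next
    case False
    then have "u < v" using uv by simp
    then have "\<forall>\<^sub>F s in at_top. 2 * C * \<bar>\<eta> j s\<bar> < \<epsilon> / 2 * (v - u)" if "j < n" for j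
    proof -
      have "((\<lambda>s. 2 * C * \<bar>\<eta> j s\<bar>) \<longlongrightarrow> 2 * C * \<bar>0\<bar>) at_top"
        by (intro tendsto_intros \<eta> that)
      then show ?thesis
        using \<epsilon> \<open>u < v\<close> by (intro order_tendstoD(2)) auto
    qed
    then have "\<forall>\<^sub>F s in at_top. \<forall>j\<in>{..<n}. 2 * C * \<bar>\<eta> j s\<bar> < \<epsilon> / 2 * (v - u)"
      by (intro eventually_ball_finite) auto
    with Q show ?thesis
    proof eventually_elim
      case (elim s)
      have contF\<eta>: "continuous_on UNIV (\<lambda>t. F s (t + \<eta> j s))" for j
        by (rule continuous_on_compose2[OF contF]) (auto intro!: continuous_intros)
      have contD: "continuous_on UNIV (D s)"
        unfolding D_def using n by (intro continuous_intros contF\<eta> contA) simp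
      have int: "f integrable_on {u..v}" if "continuous_on UNIV f" for f :: "real \<Rightarrow> complex"
        by (rule integrable_continuous_interval[OF continuous_on_subset[OF that]]) simp
      note int_shift = int[OF contF\<eta>]
      have 1: "norm (integral {u..v} (D s)) \<le> \<epsilon> / 2 * (v - u)"
      proof (rule integral_bound)
        show "u \<le> v" using uv by simp
        show "continuous_on {u..v} (D s)"
          by (rule continuous_on_subset[OF contD]) simp
        show "norm (D s t) \<le> \<epsilon> / 2" if "t \<in> {u..v}" for t
          using that uv elim by (intro PQ d) (auto simp: dist_real_def)
      qed
      have "integral {u..v} (D s) =
          (\<Sum>j<n. integral {u..v} (\<lambda>t. F s (t + \<eta> j s))) / of_nat n - integral {u..v} (A s)"
        unfolding D_def
        by (subst Henstock_Kurzweil_Integration.integral_diff)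
          (auto intro!: int continuous_intros contF\<eta> contA
            simp: n int_shift Henstock_Kurzweil_Integration.integral_sum)
      moreover have "integral {u..v} (F s) = (\<Sum>j<n. integral {u..v} (F s)) / of_nat n"
        using n by simp
      \<comment> \<open>Writing the integral of \<open>F s\<close> as the average of
        \<open>n\<close> copies of itself, what remains besides the approximation error
        \<open>D s\<close> is an average of shift errors.\<close>
      ultimately have "integral {u..v} (F s) - integral {u..v} (A s) - integral {u..v} (D s) =
          (\<Sum>j<n. integral {u..v} (F s) - integral {u..v} (\<lambda>t. F s (t + \<eta> j s))) / of_nat n"
        by (simp add: sum_subtractf diff_divide_distrib)
      also have "norm \<dots> \<le> \<epsilon> / 2 * (v - u)"
      proof -
        have "norm (integral {u..v} (F s) - integral {u..v} (\<lambda>t. F s (t + \<eta> j s)))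
            \<le> \<epsilon> / 2 * (v - u)" if "j < n" for j
        proof -
          have "norm (integral {u..v} (F s) - integral {u..v} (\<lambda>t. F s (t + \<eta> j s)))
              \<le> 2 * C * \<bar>\<eta> j s\<bar>"
            using norm_integral_shift_diff_le[OF contF bound, of u v s "\<eta> j s"] \<open>u < v\<close>
            by (simp add: norm_minus_commute)
          also have "\<dots> \<le> \<epsilon> / 2 * (v - u)"
            using elim(2) that by (meson less_imp_le lessThan_iff)
          finally show ?thesis .
        qed
        then have "norm (\<Sum>j<n. integral {u..v} (F s) - integral {u..v} (\<lambda>t. F s (t + \<eta> j s)))
            \<le> of_nat n * (\<epsilon> / 2 * (v - u))"
          using sum_norm_bound[of "{..<n}" "\<lambda>j. integral {u..v} (F s) -
            integral {u..v} (\<lambda>t. F s (t + \<eta> j s))" "\<epsilon> / 2 * (v - u)"] by simp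
        then show ?thesis
          using n by (simp add: norm_divide divide_le_eq mult.commute)
      qed
      finally show ?case
        using 1 norm_triangle_sub[of "integral {u..v} (F s) - integral {u..v} (A s)"
            "integral {u..v} (D s)"] by (simp add: field_simps)
    qed
  qed
  then show ?thesis using d(1) by blast
qed

text \<open>If a vanishing shift nearly reverses the sign of \<open>F\<close>, the average of the
  unshifted and the shifted function is nearly \<open>0\<close>. This is the averaging lemma with
  two shifts and \<open>A = 0\<close>.\<close>

lemma integral_tendsto_zero_sign_change:
  fixes F :: "real \<Rightarrow> real \<Rightarrow> complex"
  assumes cont: "\<And>s. continuous_on UNIV (F s)" and bound: "\<And>s t. norm (F s t) \<le> C"
    and B: "finite B"
    and sign: "\<And>x. x \<notin> B \<Longrightarrow> \<exists>\<eta>. (\<eta> \<longlongrightarrow> 0) at_top \<and>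
      ((\<lambda>p. F (snd p) (fst p + \<eta> (snd p)) + F (snd p) (fst p)) \<longlongrightarrow> 0) (nhds x \<times>\<^sub>F at_top)"
    and "a \<le> b"
  shows "((\<lambda>s. integral {a..b} (F s)) \<longlongrightarrow> 0) at_top"
proof (rule integral_tendsto_zero_locally[OF cont bound B _ \<open>a \<le> b\<close>])
  fix x \<epsilon> :: real assume "x \<notin> B" and \<epsilon>: "\<epsilon> > 0"
  then obtain \<eta> where \<eta>: "(\<eta> \<longlongrightarrow> 0) at_top" and
    lim: "((\<lambda>p. F (snd p) (fst p + \<eta> (snd p)) + F (snd p) (fst p)) \<longlongrightarrow> 0) (nhds x \<times>\<^sub>F at_top)"
    using sign by blast
  define \<eta>' where "\<eta>' = (\<lambda>(j::nat) s. if j = 0 then 0 else \<eta> s)"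
  have "\<exists>d>0. \<forall>u v. u \<le> x \<and> x \<le> v \<and> v - u < d \<longrightarrow>
    (\<forall>\<^sub>F s in at_top. norm (integral {u..v} (F s) - integral {u..v} ((\<lambda>s t. 0) s)) \<le> \<epsilon> * (v - u))"
  proof (rule integral_shift_average[OF cont bound _ _ _ _ \<epsilon>])
    show "(\<eta>' j \<longlongrightarrow> 0) at_top" for j :: nat
      using \<eta> by (cases "j = 0") (simp_all add: \<eta>'_def)
    show "\<forall>\<^sub>F p in nhds x \<times>\<^sub>F at_top.
      norm ((\<Sum>j<(2::nat). F (snd p) (fst p + \<eta>' j (snd p))) / of_nat 2 - 0) \<le> e" if "e > 0" for e
      using tendstoD[OF lim that]
    proof eventually_elim
      case (elim p)
      then show ?case
        using \<open>e > 0\<close>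
        by (simp add: \<eta>'_def norm_divide numeral_2_eq_2 lessThan_Suc add.commute)
    qed
  qed auto
  then show "\<exists>d>0. \<forall>u v. u \<le> x \<and> x \<le> v \<and> v - u < d \<longrightarrow>
    (\<forall>\<^sub>F s in at_top. norm (integral {u..v} (F s)) \<le> \<epsilon> * (v - u))"
    by simp
qed

section \<open>Taylor expansion of polynomials with continuous remainder\<close>

text \<open>The remainder is jointly continuous in \<open>t\<close> and \<open>\<eta>\<close>, so
  that limits can be taken as the base point tends to \<open>x\<close> and the shift to zero at
  once.\<close>

lemma poly_taylor:
  fixes p :: "real poly"
  shows "\<exists>r. continuous_on UNIV r \<and>
    (\<forall>t \<eta>. poly p (t + \<eta>) = poly p t + \<eta> * poly (pderiv p) t + \<eta>\<^sup>2 * r (t, \<eta>))"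
proof (induction p)
  case 0
  show ?case by (intro exI[of _ "\<lambda>_. 0"]) simp
next
  case (pCons c p)
  then obtain r where r: "continuous_on UNIV r"
    "\<And>t \<eta>. poly p (t + \<eta>) = poly p t + \<eta> * poly (pderiv p) t + \<eta>\<^sup>2 * r (t, \<eta>)"
    by blast
  define r' where "r' = (\<lambda>z. fst z * r z + poly (pderiv p) (fst z) + snd z * r z)"
  have "continuous_on UNIV r'"
    unfolding r'_def by (intro continuous_intros r(1))
  moreover have "poly (pCons c p) (t + \<eta>) =
      poly (pCons c p) t + \<eta> * poly (pderiv (pCons c p)) t + \<eta>\<^sup>2 * r' (t, \<eta>)" for t \<eta>
    unfolding r'_def pderiv_pCons poly_pCons poly_add r(2)[of t \<eta>] fst_conv snd_conv by algebra
  ultimately show ?case by blast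
qed

lemma real_polynomial_function_poly:
  assumes "real_polynomial_function (f :: real \<Rightarrow> real)"
  obtains p where "f = poly p"
proof -
  obtain a n where f: "f = (\<lambda>x. \<Sum>i\<le>n. a i * x ^ i)"
    using assms unfolding real_polynomial_function_iff_sum by blast
  have "f = poly (\<Sum>i\<le>n. monom (a i) i)"
    by (auto simp: f poly_sum poly_monom)
  then show ?thesis using that by blast
qed

lemma real_polynomial_function_of_poly: "real_polynomial_function (poly (p :: real poly))"
  unfolding real_polynomial_function_iff_sum poly_altdef[abs_def] by blast

lemma real_polynomial_function_finite_zeros:
  fixes f :: "real \<Rightarrow> real"
  assumes "real_polynomial_function f" and "f t \<noteq> 0"
  shows "finite {t. f t = 0}"
proof -
  obtain p where f: "f = poly p"
    using assms(1) by (rule real_polynomial_function_poly)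
  with assms(2) have "p \<noteq> 0" by auto
  then show ?thesis
    unfolding f by (rule poly_roots_finite)
qed

text \<open>The coefficient \<open>f'\<close> comes from \<open>pderiv\<close>. The last clause
  makes it usable for nonconstancy: a nonconstant polynomial has \<open>f'\<close> not identically
  zero, hence with finitely many zeros.\<close>

lemma real_polynomial_function_taylor:
  fixes f :: "real \<Rightarrow> real"
  assumes "real_polynomial_function f"
  obtains f' r where "real_polynomial_function f'" "continuous_on UNIV r"
    "\<And>t \<eta>. f (t + \<eta>) = f t + \<eta> * f' t + \<eta>\<^sup>2 * r (t, \<eta>)"
    "(\<And>t. f' t = 0) \<Longrightarrow> \<exists>c. \<forall>t. f t = c"
proof -
  obtain p where f: "f = poly p"
    using assms by (rule real_polynomial_function_poly)
  obtain r where r: "continuous_on UNIV r"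
    "\<And>t \<eta>. poly p (t + \<eta>) = poly p t + \<eta> * poly (pderiv p) t + \<eta>\<^sup>2 * r (t, \<eta>)"
    using poly_taylor by blast
  have "\<exists>c. \<forall>t. f t = c" if "\<And>t. poly (pderiv p) t = 0"
  proof -
    have "pderiv p = 0"
      using that poly_all_0_iff_0 by blast
    then obtain c where "p = [:c:]"
      unfolding pderiv_eq_0_iff by (rule degree_eq_zeroE)
    then show ?thesis by (simp add: f)
  qed
  then show ?thesis
    using that[OF real_polynomial_function_of_poly r(1), of "pderiv p"] r(2) by (auto simp: f)
qed

lemma polynomial_function_taylor:
  fixes f :: "real \<Rightarrow> real ^ 'n::finite"
  assumes "polynomial_function f"
  obtains f' r where "\<And>i. real_polynomial_function (\<lambda>t. f' t $ i)" "continuous_on UNIV r"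
    "\<And>t \<eta>. f (t + \<eta>) = f t + \<eta> *\<^sub>R f' t + \<eta>\<^sup>2 *\<^sub>R r (t, \<eta>)"
    "\<And>i. (\<And>t. f' t $ i = 0) \<Longrightarrow> \<exists>c. \<forall>t. f t $ i = c"
proof -
  have "real_polynomial_function (\<lambda>t. f t $ i)" for i
    using assms bounded_linear_vec_nth[of i] by (auto simp: polynomial_function_def o_def)
  then have "\<exists>f' r. real_polynomial_function f' \<and> continuous_on UNIV r \<and>
    (\<forall>t \<eta>. f (t + \<eta>) $ i = f t $ i + \<eta> * f' t + \<eta>\<^sup>2 * r (t, \<eta>)) \<and>
    ((\<forall>t. f' t = 0) \<longrightarrow> (\<exists>c. \<forall>t. f t $ i = c))" for i
    by (rule real_polynomial_function_taylor) blast
  then obtain f' r where *: "\<And>i. real_polynomial_function (f' i)" "\<And>i. continuous_on UNIV (r i)"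
    "\<And>i t \<eta>. f (t + \<eta>) $ i = f t $ i + \<eta> * f' i t + \<eta>\<^sup>2 * r i (t, \<eta>)"
    "\<And>i. (\<And>t. f' i t = 0) \<Longrightarrow> \<exists>c. \<forall>t. f t $ i = c"
    by metis
  show ?thesis
  proof (rule that[of "\<lambda>t. \<chi> i. f' i t" "\<lambda>z. \<chi> i. r i z"])
    show "continuous_on UNIV (\<lambda>z. \<chi> i. r i z)"
      by (intro continuous_on_vec_lambda *)
  qed (use * in \<open>simp_all add: vec_eq_iff\<close>)
qed

section \<open>Equidistribution in the torus\<close>

lemma integral_distr_curve:
  fixes \<gamma> :: "real \<Rightarrow> 'a::topological_space" and f :: "'a \<Rightarrow> real"
  assumes \<gamma>: "continuous_on UNIV \<gamma>" and f: "continuous_on UNIV f"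
  shows "(\<integral>x. f x \<partial>distr (lebesgue_on {0..1}) borel \<gamma>) = integral {0..1} (\<lambda>t. f (\<gamma> t))"
proof -
  have "\<gamma> \<in> borel_measurable borel"
    using \<gamma> by (rule borel_measurable_continuous_onI)
  then have "\<gamma> \<in> borel_measurable (lebesgue_on {0..1})"
    by (intro measurable_restrict_space1 measurable_completion) simp
  moreover have "continuous_on {0..1} (\<lambda>t. f (\<gamma> t))"
    using continuous_on_compose2[OF f continuous_on_subset[OF \<gamma>]] by auto
  then have "integrable (lebesgue_on {0..1}) (\<lambda>t. f (\<gamma> t))"
    by (rule continuous_imp_integrable_real)
  ultimately show ?thesis
    using borel_measurable_continuous_onI[OF f]
    by (simp add: integral_distr lebesgue_integral_eq_integral)
qed

lemma continuous_scale_curve: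
  fixes A :: "real \<Rightarrow> (real ^ 'n::finite) \<times> (real ^ 'n)"
  assumes "continuous_on UNIV A"
  shows "continuous_on UNIV (\<lambda>t. torus_proj (s *\<^sub>R A t))"
  by (rule continuous_on_compose2[OF continuous_torus_proj])
    (auto intro!: continuous_intros assms)

text \<open>Points of this product filter are pairs of a time near \<open>x\<close> and a large
  scale; these limits feed all later Taylor estimates.\<close>

lemma nhds_prod_at_top_limits:
  fixes x :: real
  shows "(fst \<longlongrightarrow> x) (nhds x \<times>\<^sub>F (at_top :: real filter))"
    and "((\<lambda>p. h / snd p) \<longlongrightarrow> (0::real)) (nhds x \<times>\<^sub>F at_top)"
    and "\<forall>\<^sub>F p in nhds x \<times>\<^sub>F at_top. snd p > (0::real)"
proof -
  show "(fst \<longlongrightarrow> x) (nhds x \<times>\<^sub>F (at_top :: real filter))"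
    by (rule filterlim_fst)
  have snd: "filterlim snd at_top (nhds x \<times>\<^sub>F (at_top :: real filter))"
    by (rule filterlim_snd)
  then show "((\<lambda>p. h / snd p) \<longlongrightarrow> 0) (nhds x \<times>\<^sub>F at_top)"
    by (intro real_tendsto_divide_at_top[OF tendsto_const])
  show "\<forall>\<^sub>F p in nhds x \<times>\<^sub>F at_top. snd p > (0::real)"
    using snd by (simp add: filterlim_at_top_dense)
qed

lemma tendsto_remainder:
  fixes r :: "real \<times> real \<Rightarrow> 'b::topological_space" and x :: real
  assumes r: "continuous_on UNIV r" and \<eta>: "(\<eta> \<longlongrightarrow> 0) (nhds x \<times>\<^sub>F (at_top :: real filter))"
  shows "((\<lambda>p. r (fst p, \<eta> p)) \<longlongrightarrow> r (x, 0)) (nhds x \<times>\<^sub>F at_top)"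
proof -
  have "isCont r (x, 0)"
    using r by (simp add: continuous_on_eq_continuous_at)
  then show ?thesis
    by (rule isCont_tendsto_compose) (intro tendsto_Pair nhds_prod_at_top_limits \<eta>)
qed

lemma tendsto_continuous_fst:
  fixes f :: "real \<Rightarrow> 'b::topological_space"
  assumes "continuous_on UNIV f"
  shows "((\<lambda>p. f (fst p)) \<longlongrightarrow> f x) (nhds x \<times>\<^sub>F (at_top :: real filter))"
proof -
  have "isCont f x"
    using assms by (simp add: continuous_on_eq_continuous_at)
  then show ?thesis
    by (rule isCont_tendsto_compose) (rule nhds_prod_at_top_limits)
qed

lemma continuous_on_real_polynomial_function:
  fixes f :: "real \<Rightarrow> real"
  shows "real_polynomial_function f \<Longrightarrow> continuous_on S f"
  using continuous_real_polymonial_function continuous_at_imp_continuous_on by blast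

lemma tendsto_ei [tendsto_intros]: "(f \<longlongrightarrow> l) F \<Longrightarrow> ((\<lambda>x. ei (f x)) \<longlongrightarrow> ei l) F"
  by (rule continuous_on_tendsto_compose[where s = UNIV])
    (auto intro: continuous_on_ei continuous_on_id)

text \<open>Wherever \<open>P'\<close> does not vanish, a shift by \<open>h / s\<close> changes the
  phase \<open>s * P t\<close> by about \<open>h * P' t\<close>, and \<open>h\<close> can be chosen
  to make this a half turn. No stationary phase estimate is needed, since zeros of \<open>P'\<close>
  are finite in number.\<close>

lemma oscillatory_integral_tendsto_zero:
  fixes P :: "real \<Rightarrow> real"
  assumes P: "real_polynomial_function P" and nonconst: "\<not> (\<exists>c. \<forall>t. P t = c)" and "u \<le> v"
  shows "((\<lambda>s. integral {u..v} (\<lambda>t. ei (s * P t))) \<longlongrightarrow> 0) at_top"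
proof -
  obtain P' r where P': "real_polynomial_function P'" and r: "continuous_on UNIV r"
    and taylor: "\<And>t \<eta>. P (t + \<eta>) = P t + \<eta> * P' t + \<eta>\<^sup>2 * r (t, \<eta>)"
    and "(\<And>t. P' t = 0) \<Longrightarrow> \<exists>c. \<forall>t. P t = c"
    using P by (rule real_polynomial_function_taylor) blast
  then obtain t where "P' t \<noteq> 0"
    using nonconst by blast
  then have fin: "finite {t. P' t = 0}"
    by (rule real_polynomial_function_finite_zeros[OF P'])
  have contP: "continuous_on UNIV P"
    using P by (rule continuous_on_real_polynomial_function)
  show ?thesis
  proof (rule integral_tendsto_zero_sign_change[OF _ _ fin _ \<open>u \<le> v\<close>, where C = 1])
    show "continuous_on UNIV (\<lambda>t. ei (s * P t))" for s
      by (intro continuous_intros contP)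
    show "norm (ei (s * P t)) \<le> 1" for s t
      by simp
    fix x assume "x \<notin> {t. P' t = 0}"
    then have x: "P' x \<noteq> 0" by simp
    define h where "h = 1 / (2 * P' x)"
    let ?F = "nhds x \<times>\<^sub>F (at_top :: real filter)"
    have "((\<lambda>p. 1 + ei (h * P' (fst p) + h * (h / snd p) * r (fst p, h / snd p)))
        \<longlongrightarrow> 1 + ei (h * P' x + h * 0 * r (x, 0))) ?F"
      by (intro tendsto_intros tendsto_continuous_fst[OF continuous_on_real_polynomial_function[OF P']]
          nhds_prod_at_top_limits tendsto_remainder[OF r])
    moreover have "h * P' x = 1 / 2"
      using x by (simp add: h_def)
    ultimately have "((\<lambda>p. 1 + ei (h * P' (fst p) + h * (h / snd p) * r (fst p, h / snd p))) \<longlongrightarrow> 0) ?F"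
      by simp
    then have lim: "((\<lambda>p. norm (1 + ei (h * P' (fst p) + h * (h / snd p) * r (fst p, h / snd p))))
        \<longlongrightarrow> 0) ?F"
      by (rule tendsto_norm_zero)
    have "((\<lambda>p. norm (ei (snd p * P (fst p + h / snd p)) + ei (snd p * P (fst p)))) \<longlongrightarrow> 0) ?F"
    proof (rule Lim_transform_eventually[OF lim])
      show "\<forall>\<^sub>F p in ?F. norm (1 + ei (h * P' (fst p) + h * (h / snd p) * r (fst p, h / snd p))) =
        norm (ei (snd p * P (fst p + h / snd p)) + ei (snd p * P (fst p)))"
        using nhds_prod_at_top_limits(3)
      proof eventually_elim
        case (elim p)
        have "snd p * P (fst p + h / snd p) = snd p * P (fst p) +
            (h * P' (fst p) + h * (h / snd p) * r (fst p, h / snd p))"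
          using elim unfolding taylor by (simp add: field_simps power2_eq_square)
        then have "ei (snd p * P (fst p + h / snd p)) + ei (snd p * P (fst p)) =
            ei (snd p * P (fst p)) *
              (1 + ei (h * P' (fst p) + h * (h / snd p) * r (fst p, h / snd p)))"
          by (simp only: ei_add) (simp add: algebra_simps)
        then show ?case
          by (simp add: norm_mult)
      qed
    qed
    then have "((\<lambda>p. ei (snd p * P (fst p + h / snd p)) + ei (snd p * P (fst p))) \<longlongrightarrow> 0) ?F"
      by (rule tendsto_norm_zero_cancel)
    moreover have "((\<lambda>s. h / s) \<longlongrightarrow> 0) at_top"
      by (intro real_tendsto_divide_at_top[OF tendsto_const] filterlim_ident)
    ultimately show "\<exists>\<eta>. (\<eta> \<longlongrightarrow> 0) at_top \<and>
      ((\<lambda>p. ei (snd p * P (fst p + \<eta> (snd p))) + ei (snd p * P (fst p))) \<longlongrightarrow> 0) ?F"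
      by blast
  qed
qed

text \<open>If the character is constant along the curve, its integral along the dilated curve is
  the unimodular number \<open>ei (sqrt r * d)\<close>, which cannot tend to the Haar integral
  \<open>0\<close>.\<close>

lemma torus_dilation_nonconstant:
  fixes a b :: "real \<Rightarrow> real ^ 'n::finite"
  assumes A: "continuous_on UNIV (\<lambda>t. (a t, b t))"
    and p: "\<And>t. p t = (a t, b t, c t)"
    and h: "invariant_prob_measure torus_translate h"
    and conv: "weak_star_tendsto (torus_dilation_measure p) h at_top"
    and \<kappa>: "\<kappa> \<in> int_vectors \<times> int_vectors" "\<kappa> \<noteq> 0"
  shows "\<not> (\<exists>c. \<forall>t. \<kappa> \<bullet> (a t, b t) = c)"
proof
  assume "\<exists>c. \<forall>t. \<kappa> \<bullet> (a t, b t) = c"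
  then obtain d where d: "\<And>t. \<kappa> \<bullet> (a t, b t) = d"
    by blast
  obtain H where H: "torus_char \<kappa> H" "\<And>v. H (torus_proj v) = ei (\<kappa> \<bullet> v)"
    using torus_char_exists[OF \<kappa>(1)] by blast
  have lim: "((\<lambda>r. Re (K * ei (sqrt r * d))) \<longlongrightarrow> 0) at_top" for K
  proof -
    have contH: "continuous_on UNIV H"
      using H(1) by (simp add: torus_char_def)
    have contKH: "continuous_on UNIV (\<lambda>x. K * H x)"
      by (intro continuous_intros contH)
    have KH: "torus_char \<kappa> (\<lambda>x. K * H x)"
      using H contKH by (simp add: torus_char_def)
    have cont: "continuous_on UNIV (\<lambda>x. Re (K * H x))"
      by (intro continuous_intros contH)
    have "((\<lambda>r. \<integral>x. Re (K * H x) \<partial>torus_dilation_measure p r) \<longlongrightarrow> (\<integral>x. Re (K * H x) \<partial>h)) at_top"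
      using conv cont unfolding weak_star_tendsto_def by blast
    moreover have "(\<integral>x. Re (K * H x) \<partial>torus_dilation_measure p r) = Re (K * ei (sqrt r * d))" for r
    proof -
      have hor: "horizontal (heis_dilate r (p t)) = sqrt r *\<^sub>R (a t, b t)" for t
        by (simp add: p heis_dilate_def horizontal_def)
      have "(\<integral>x. Re (K * H x) \<partial>torus_dilation_measure p r) =
          integral {0..1} (\<lambda>t. Re (K * H (torus_proj (sqrt r *\<^sub>R (a t, b t)))))"
        unfolding torus_dilation_measure_def hor
        by (rule integral_distr_curve[OF continuous_scale_curve[OF A] cont])
      also have "\<dots> = integral {0..1::real} (\<lambda>t. Re (K * ei (sqrt r * d)))"
        by (simp only: H inner_scaleR_right d)
      finally show ?thesis by simp
    qed
    ultimately show ?thesis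
      by (simp only: torus_char_integral_zero[OF h KH \<kappa>(2)])
  qed
  \<comment> \<open>Only real test functions are allowed, so the multiples \<open>1\<close> and
    \<open>- \<i>\<close> are used to obtain real and imaginary part; their squares add up to
    \<open>1\<close>.\<close>
  have "((\<lambda>r. (Re (1 * ei (sqrt r * d)))\<^sup>2 + (Re (- \<i> * ei (sqrt r * d)))\<^sup>2) \<longlongrightarrow> 0\<^sup>2 + 0\<^sup>2) at_top"
    by (intro tendsto_intros lim)
  moreover have "(Re (1 * ei w))\<^sup>2 + (Re (- \<i> * ei w))\<^sup>2 = 1" for w
    using norm_ei[of w] cmod_power2[of "ei w"] by simp
  ultimately show False
    by (simp add: tendsto_const_iff)
qed

lemma real_polynomial_function_inner_pair:
  fixes a b :: "real \<Rightarrow> real ^ 'n::finite"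
  assumes "polynomial_function a" "polynomial_function b"
  shows "real_polynomial_function (\<lambda>t. \<kappa> \<bullet> (a t, b t))"
proof -
  have "real_polynomial_function ((\<lambda>v. k \<bullet> v) \<circ> f)"
    if "polynomial_function f" for f :: "real \<Rightarrow> real ^ 'n" and k
    using that bounded_linear_inner_right[of k] unfolding polynomial_function_def by blast
  from real_polynomial_function.intros(3)[OF this[OF assms(1), of "fst \<kappa>"] this[OF assms(2), of "snd \<kappa>"]]
  show ?thesis
    by (simp add: inner_prod_def)
qed

text \<open>Along the dilated curve a nonzero frequency becomes an oscillatory integral with
  nonconstant polynomial phase, so Weyl's criterion applies on each interval. Subintervals matter
  because the averaging argument for vertical characters is local in time.\<close>

lemma torus_equidistribution_subinterval:
  fixes a b :: "real \<Rightarrow> real ^ 'n::finite"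
  assumes a: "polynomial_function a" and b: "polynomial_function b"
    and nonconst: "\<And>\<kappa>. \<kappa> \<in> int_vectors \<times> int_vectors \<Longrightarrow> \<kappa> \<noteq> 0 \<Longrightarrow>
      \<not> (\<exists>c. \<forall>t. \<kappa> \<bullet> (a t, b t) = c)"
    and h: "invariant_prob_measure torus_translate h"
    and f: "continuous_on UNIV f" and uv: "u \<le> v"
  shows "((\<lambda>s. integral {u..v} (\<lambda>t. f (torus_proj (s *\<^sub>R (a t, b t))))) \<longlongrightarrow>
    (v - u) * (\<integral>x. f x \<partial>h)) at_top"
proof (rule torus_weyl[OF h bounded_functional_curve[OF continuous_scale_curve uv] _ _ _ f])
  show "continuous_on UNIV (\<lambda>t. (a t, b t))"
    using a b by (intro continuous_intros continuous_on_polymonial_function)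
  show "0 \<le> v - u" using uv by simp
  show "((\<lambda>s. integral {u..v} (\<lambda>t. c)) \<longlongrightarrow> (v - u) * c) at_top" for c :: real
    using uv by simp
  fix \<kappa> :: "(real ^ 'n) \<times> (real ^ 'n)" and H
  assume \<kappa>: "\<kappa> \<in> int_vectors \<times> int_vectors" "\<kappa> \<noteq> 0" and H: "torus_char \<kappa> H"
  let ?P = "\<lambda>t. \<kappa> \<bullet> (a t, b t)"
  let ?c = "H (torus_proj 0)"
  have P: "real_polynomial_function ?P"
    by (rule real_polynomial_function_inner_pair[OF a b])
  have contP: "continuous_on UNIV ?P"
    using P by (rule continuous_on_real_polynomial_function)
  have "((\<lambda>s. Re (?c * integral {u..v} (\<lambda>t. ei (s * ?P t)))) \<longlongrightarrow> Re (?c * 0)) at_top"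
    by (intro tendsto_intros oscillatory_integral_tendsto_zero[OF P nonconst[OF \<kappa>] uv])
  moreover have "Re (?c * integral {u..v} (\<lambda>t. ei (s * ?P t))) =
      integral {u..v} (\<lambda>t. Re (H (torus_proj (s *\<^sub>R (a t, b t)))))" for s
  proof -
    have H': "H (torus_proj (s *\<^sub>R (a t, b t))) = ?c * ei (s * ?P t)" for t
      using H unfolding torus_char_def by (metis inner_scaleR_right)
    have "continuous_on {u..v} (\<lambda>t. ei (s * ?P t))"
      by (intro continuous_intros continuous_on_subset[OF contP]) simp
    then have "(\<lambda>t. ei (s * ?P t)) integrable_on {u..v}"
      by (rule integrable_continuous_interval)
    moreover have "bounded_linear (\<lambda>z. Re (?c * z))"
      by (rule bounded_linear_compose[OF bounded_linear_Re bounded_linear_mult_right])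
    ultimately show ?thesis
      unfolding H' using integral_linear by (fastforce simp: o_def)
  qed
  ultimately show "((\<lambda>s. integral {u..v} (\<lambda>t. Re (H (torus_proj (s *\<^sub>R (a t, b t)))))) \<longlongrightarrow> 0) at_top"
    by simp
qed

section \<open>Correlations of vertical characters\<close>

text \<open>Centre-invariance makes the values on the slice with central coordinate \<open>0\<close>
  independent of the lift: two lifts of one torus point agree modulo the lattice after a central
  translation.\<close>

lemma vertical_invariant_descends:
  fixes \<Psi> :: "'n::finite nilmanifold \<Rightarrow> 'b::topological_space"
  assumes cont: "continuous_on UNIV \<Psi>"
    and inv: "\<And>w x. \<Psi> (nil_translate (0, 0, w) x) = \<Psi> x"
  obtains f where "continuous_on UNIV f" "\<And>x. \<Psi> x = f (nil_horizontal x)"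
proof -
  let ?f = "\<lambda>v. \<Psi> (nil_proj (fst v, snd v, 0))"
  have "continuous_on UNIV (\<lambda>v :: (real ^ 'n) \<times> (real ^ 'n). nil_proj (fst v, snd v, 0))"
    by (rule continuous_on_compose2[OF continuous_nil_proj]) (auto intro!: continuous_intros)
  from continuous_on_compose2[OF cont this] have "continuous_on UNIV ?f"
    by simp
  moreover have "\<Psi> (nil_proj (x, y, z)) = ?f (x', y')" if "torus_rel (x, y) (x', y')" for x y z x' y'
  proof -
    have "nil_translate (0, 0, - (z + x \<bullet> (y' - y))) (nil_proj (x, y, z)) = nil_proj (x', y', 0)"
      using that by (simp add: nil_translate_proj heis_mult_def nil_proj_eq_iff heis_rel_iff torus_rel_def)
    then show ?thesis
      using inv by (metis fst_conv snd_conv)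
  qed
  note fibre = this
  then have "?f v = ?f w" if "torus_rel v w" for v w
    using that by (cases v; cases w) simp
  ultimately obtain f where f: "continuous_on UNIV f" "\<And>v. f (torus_proj v) = ?f v"
    using torus_lift[of ?f] by blast
  have "\<Psi> x = f (nil_horizontal x)" for x
  proof -
    obtain g where x: "x = nil_proj g"
      using surj_nil_proj by blast
    have "torus_rel (fst g, fst (snd g)) (fst g, fst (snd g))"
      using equivp_reflp[OF equivp_torus_rel] .
    from fibre[OF this, of "snd (snd g)"] show ?thesis
      by (simp add: x nil_horizontal_proj f horizontal_def case_prod_beta)
  qed
  then show ?thesis
    using f(1) that by blast
qed

text \<open>Substituting a small \<open>y\<close>-translate does not change the integral. Commuting
  it past \<open>g\<close> and \<open>g'\<close> gives central elements whose phases differ by a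
  half turn, by the choice of \<open>\<delta>\<close>. So the integrand turns into nearly its
  negative, with error controlled by \<open>\<omega>\<close>.\<close>

lemma vertical_correlation_le:
  fixes H :: "'n::finite nilmanifold \<Rightarrow> complex"
  assumes H: "vertical_char l H" and m: "invariant_prob_measure nil_translate m"
    and bound: "\<And>x. norm (H x) \<le> C"
    and g: "g = (x, y, z)" "g' = (x', y', z')"
    and \<delta>: "of_int l * (\<delta> * (x $ i - x' $ i)) = 1 / 2"
    and close: "\<And>w. norm (H (nil_translate (0, \<delta> *\<^sub>R axis i 1, 0) w) - H w) \<le> \<omega>"
  shows "\<bar>\<integral>w. Re (H (nil_translate g w) * cnj (H (nil_translate g' w))) \<partial>m\<bar> \<le> C * \<omega>"
proof -
  define u :: "'n heis" where "u = (0, \<delta> *\<^sub>R axis i 1, 0)"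
  define \<Phi> where "\<Phi> w = H (nil_translate g w) * cnj (H (nil_translate g' w))" for w
  \<comment> \<open>The same product with \<open>u\<close> moved to the left of both translations,
    where it can be compared with the identity through \<open>close\<close>.\<close>
  define \<Phi>u where "\<Phi>u w = H (nil_translate u (nil_translate g w)) *
    cnj (H (nil_translate u (nil_translate g' w)))" for w
  note cont = continuous_on_compose2[OF vertical_charD(1)[OF H] continuous_nil_translate]
  have cont\<Phi>: "continuous_on UNIV (\<lambda>w. Re (\<Phi> w))"
    unfolding \<Phi>_def by (intro continuous_intros cont) auto
  have shift: "H (nil_translate (v, v', v'') (nil_translate u w)) =
      ei (of_int l * (\<delta> * v $ i)) * H (nil_translate u (nil_translate (v, v', v'') w))" for v v' v'' w
  proof -
    have "nil_translate (v, v', v'') (nil_translate u w) =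
        nil_translate (0, 0, \<delta> * v $ i) (nil_translate u (nil_translate (v, v', v'') w))"
      by (simp add: nil_translate_translate heis_mult_def u_def inner_axis add.commute)
    then show ?thesis
      by (simp add: vertical_charD(2)[OF H])
  qed
  have anti: "\<Phi> (nil_translate u w) = - \<Phi>u w" for w
  proof -
    have "\<Phi> (nil_translate u w) =
        (ei (of_int l * (\<delta> * x $ i)) * ei (- (of_int l * (\<delta> * x' $ i)))) * \<Phi>u w"
      unfolding \<Phi>_def \<Phi>u_def g shift by (simp add: cnj_ei)
    also have "ei (of_int l * (\<delta> * x $ i)) * ei (- (of_int l * (\<delta> * x' $ i))) = ei (1 / 2)"
      unfolding ei_add[symmetric] by (rule arg_cong[where f = ei]) (use \<delta> in \<open>simp add: algebra_simps\<close>)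
    finally show ?thesis by simp
  qed
  have diff: "norm (\<Phi> w - \<Phi>u w) \<le> 2 * (C * \<omega>)" for w
  proof -
    let ?h = "H (nil_translate g w)" and ?h' = "H (nil_translate g' w)"
    let ?k = "H (nil_translate u (nil_translate g w))" and ?k' = "H (nil_translate u (nil_translate g' w))"
    have "\<Phi> w - \<Phi>u w = (?h - ?k) * cnj ?h' + ?k * cnj (?h' - ?k')"
      by (simp add: \<Phi>_def \<Phi>u_def algebra_simps)
    then have "norm (\<Phi> w - \<Phi>u w) \<le> norm ((?h - ?k) * cnj ?h') + norm (?k * cnj (?h' - ?k'))"
      by (simp only: norm_triangle_ineq)
    also have "\<dots> = norm (?h - ?k) * norm ?h' + norm ?k * norm (?h' - ?k')"
      by (simp only: norm_mult complex_mod_cnj)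
    also have "\<dots> \<le> \<omega> * C + C * \<omega>"
    proof (intro add_mono mult_mono)
      show "norm (?h - ?k) \<le> \<omega>" "norm (?h' - ?k') \<le> \<omega>"
        using close by (simp_all add: u_def norm_minus_commute)
      show "0 \<le> \<omega>"
        using close norm_ge_zero order_trans by blast
      show "0 \<le> C"
        using bound norm_ge_zero order_trans by blast
    qed (use bound in auto)
    finally show ?thesis by (simp add: mult.commute)
  qed
  note int = integrable_continuous_prob[OF compact_nilmanifold invariant_prob_measureD[OF m]]
  interpret prob_space m
    using invariant_prob_measureD(1)[OF m] .
  have cont\<Phi>': "continuous_on UNIV (\<lambda>w. Re (\<Phi> (nil_translate u w)))"
    by (rule continuous_on_compose2[OF cont\<Phi> continuous_nil_translate]) simp
  have "2 * (\<integral>w. Re (\<Phi> w) \<partial>m) = (\<integral>w. Re (\<Phi> w) + Re (\<Phi> (nil_translate u w)) \<partial>m)"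
    using invariant_integral[OF m continuous_nil_translate cont\<Phi>, of u]
    by (simp add: Bochner_Integration.integral_add int cont\<Phi> cont\<Phi>')
  also have "\<bar>\<dots>\<bar> \<le> 2 * (C * \<omega>)"
  proof -
    have "integrable m (\<lambda>w. Re (\<Phi> w) + Re (\<Phi> (nil_translate u w)))"
      by (intro int continuous_intros cont\<Phi> cont\<Phi>')
    note int_sum = this
    have abs: "\<bar>Re (\<Phi> w) + Re (\<Phi> (nil_translate u w))\<bar> \<le> 2 * (C * \<omega>)" for w
      using diff[of w] abs_Re_le_cmod[of "\<Phi> w - \<Phi>u w"] by (simp add: anti)
    have "(\<integral>w. Re (\<Phi> w) + Re (\<Phi> (nil_translate u w)) \<partial>m) \<le> 2 * (C * \<omega>)"
      using abs by (intro integral_le_const int_sum AE_I2) (rule abs_le_D1)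
    moreover have "- (2 * (C * \<omega>)) \<le> (\<integral>w. Re (\<Phi> w) + Re (\<Phi> (nil_translate u w)) \<partial>m)"
    proof (intro integral_ge_const int_sum AE_I2)
      show "- (2 * (C * \<omega>)) \<le> Re (\<Phi> w) + Re (\<Phi> (nil_translate u w))" for w
        using abs_le_D2[OF abs[of w]] by linarith
    qed
    ultimately show ?thesis by linarith
  qed
  finally show ?thesis by (simp add: \<Phi>_def)
qed

text \<open>
  Van der Corput's trick: translates that are far apart in the direction \<open>\<alpha>\<close> are almost orthogonal
  by the preceding lemma, so their average is small in \<open>L\<^sup>2\<close>.
\<close>

lemma vertical_average_small:
  fixes H :: "'n::finite nilmanifold \<Rightarrow> complex" and g :: "real \<Rightarrow> 'n heis"
  assumes H: "vertical_char l H" and l: "l \<noteq> 0" and m: "invariant_prob_measure nil_translate m"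
    and g: "\<And>h. fst (g h) = h *\<^sub>R \<alpha>" and \<alpha>: "\<alpha> $ i \<noteq> 0" and \<epsilon>: "\<epsilon> > 0"
  shows "\<exists>n>0. \<exists>T. (\<integral>w. norm ((\<Sum>j<n. H (nil_translate (g (real j * T)) w)) / of_nat n) \<partial>m) \<le> \<epsilon>"
proof -
  note cont = continuous_on_compose2[OF vertical_charD(1)[OF H] continuous_nil_translate]
  note int = integrable_continuous_prob[OF compact_nilmanifold invariant_prob_measureD[OF m]]
  interpret prob_space m
    using invariant_prob_measureD(1)[OF m] .
  obtain C where C: "C > 0" "\<And>x. norm (H x) \<le> C"
    by (rule bounded_on_nilmanifold[OF vertical_charD(1)[OF H]]) blast
  define \<omega> where "\<omega> = \<epsilon>\<^sup>2 / (2 * C)"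
  have \<omega>: "\<omega> > 0" "C * \<omega> = \<epsilon>\<^sup>2 / 2"
    using C \<epsilon> by (simp_all add: \<omega>_def)
  have "((\<lambda>\<delta>. (0, \<delta> *\<^sub>R axis i 1, 0)) \<longlongrightarrow> ((0, 0 *\<^sub>R axis i 1, 0) :: 'n heis)) (nhds 0)"
    by (intro tendsto_Pair tendsto_const tendsto_scaleR filterlim_ident)
  then have "filterlim (\<lambda>\<delta>. (0, \<delta> *\<^sub>R axis i 1, 0)) (nhds (heis_one :: 'n heis)) (nhds 0)"
    by (simp add: heis_one_def)
  from eventually_compose_filterlim[OF
      nil_translate_equicontinuous[OF vertical_charD(1)[OF H] \<omega>(1), of heis_one] this]
  have "\<forall>\<^sub>F \<delta> in nhds 0. \<forall>w. norm (H (nil_translate (0, \<delta> *\<^sub>R axis i 1, 0) w) - H w) < \<omega>"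
    by simp
  then obtain \<delta>0 where \<delta>0: "\<delta>0 > 0"
    "\<And>\<delta> w. \<bar>\<delta>\<bar> < \<delta>0 \<Longrightarrow> norm (H (nil_translate (0, \<delta> *\<^sub>R axis i 1, 0) w) - H w) < \<omega>"
    unfolding eventually_nhds_metric by (auto simp: dist_real_def)
  \<comment> \<open>Spacing at which two different translates need only a \<open>\<delta>\<close> of
    size at most \<open>\<delta>0 / 2\<close> to produce a half turn.\<close>
  define T where "T = 1 / (\<bar>of_int l\<bar> * \<bar>\<alpha> $ i\<bar> * \<delta>0)"
  have T: "T > 0" "\<bar>of_int l\<bar> * \<bar>\<alpha> $ i\<bar> * T = 1 / \<delta>0"
    using l \<alpha> \<delta>0 by (simp_all add: T_def)
  \<comment> \<open>The diagonal terms contribute at most \<open>C\<^sup>2 / n\<close> to the mean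
    square, which has to stay below half of \<open>\<epsilon>\<^sup>2\<close>; the off-diagonal ones
    take the other half.\<close>
  obtain n :: nat where n: "real n > 2 * C\<^sup>2 / \<epsilon>\<^sup>2"
    using reals_Archimedean2 by blast
  have "n > 0"
    using n C \<epsilon> by (intro gr0I) (auto simp: field_simps)
  have Cn: "C\<^sup>2 / real n \<le> \<epsilon>\<^sup>2 / 2"
    using n \<epsilon> \<open>n > 0\<close> by (simp add: field_simps)
  define K where "K j w = H (nil_translate (g (real j * T)) w)" for j w
  have contK: "continuous_on UNIV (K j)" for j
    unfolding K_def by (intro cont) auto
  have boundK: "norm (K j w) \<le> C" for j w
    by (simp add: K_def C)
  have corr: "(\<integral>w. Re (K j w * cnj (K k w)) \<partial>m) \<le> C * \<omega> + (if j = k then C\<^sup>2 else 0)" for j k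
  proof (cases "j = k")
    case True
    have "Re (K j w * cnj (K k w)) \<le> C\<^sup>2" for w
      using power_mono[OF boundK[of j w], of 2] by (simp add: True complex_norm_square[symmetric]
          flip: of_real_power)
    then have "(\<integral>w. Re (K j w * cnj (K k w)) \<partial>m) \<le> C\<^sup>2"
      by (intro integral_le_const int continuous_intros contK) auto
    then show ?thesis
      using \<omega> C True by (simp add: add_increasing)
  next
    case False
    define d where "d = real j - real k"
    have d: "\<bar>d\<bar> \<ge> 1"
      using False by (auto simp: d_def)
    define \<delta> where "\<delta> = 1 / (2 * of_int l * (d * T * \<alpha> $ i))"
    have "\<bar>\<delta>\<bar> = 1 / (2 * \<bar>d\<bar> * (\<bar>of_int l\<bar> * \<bar>\<alpha> $ i\<bar> * T))"
      using T(1) by (simp add: \<delta>_def abs_mult mult_ac)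
    also have "\<dots> = \<delta>0 / (2 * \<bar>d\<bar>)"
      unfolding T(2) by simp
    also have "\<dots> < \<delta>0"
      using d \<delta>0(1) by (simp add: field_simps)
    finally have \<delta>: "\<bar>\<delta>\<bar> < \<delta>0" .
    obtain x y z x' y' z' where gjk: "g (real j * T) = (x, y, z)" "g (real k * T) = (x', y', z')"
      by (metis prod_cases3)
    have "x = (real j * T) *\<^sub>R \<alpha>" "x' = (real k * T) *\<^sub>R \<alpha>"
      using g[of "real j * T"] g[of "real k * T"] by (simp_all add: gjk)
    then have "x $ i - x' $ i = d * T * \<alpha> $ i"
      by (simp add: d_def algebra_simps)
    moreover have "d \<noteq> 0" using d by auto
    ultimately have "of_int l * (\<delta> * (x $ i - x' $ i)) = 1 / 2"
      using l \<alpha> T(1) by (simp add: \<delta>_def)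
    from vertical_correlation_le[OF H m C(2) gjk this less_imp_le[OF \<delta>0(2)[OF \<delta>]]]
    show ?thesis
      using False by (simp add: K_def)
  qed
  define A where "A w = (\<Sum>j<n. K j w) / of_nat n" for w
  have contA: "continuous_on UNIV A"
    unfolding A_def using \<open>n > 0\<close> by (intro continuous_intros contK) simp
  have A2: "(norm (A w))\<^sup>2 = (\<Sum>j<n. \<Sum>k<n. Re (K j w * cnj (K k w))) / (real n)\<^sup>2" for w
  proof -
    have "(norm (\<Sum>j<n. K j w))\<^sup>2 = Re ((\<Sum>j<n. K j w) * cnj (\<Sum>k<n. K k w))"
      by (simp only: complex_norm_square[symmetric] Re_complex_of_real)
    also have "\<dots> = (\<Sum>j<n. \<Sum>k<n. Re (K j w * cnj (K k w)))"
      by (simp only: cnj_sum sum_product Re_sum)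
    finally show ?thesis
      by (simp add: A_def norm_divide power_divide)
  qed
  have "(\<integral>w. (norm (A w))\<^sup>2 \<partial>m) =
      (\<Sum>j<n. \<Sum>k<n. \<integral>w. Re (K j w * cnj (K k w)) \<partial>m) / (real n)\<^sup>2"
  proof -
    have "integrable m (\<lambda>w. Re (K j w * cnj (K k w)))" for j k
      by (intro int continuous_intros contK)
    then show ?thesis
      unfolding A2 by (simp only: integral_divide_zero Bochner_Integration.integral_sum
          Bochner_Integration.integrable_sum)
  qed
  also have "\<dots> \<le> (\<Sum>j<n. \<Sum>k<n. C * \<omega> + (if j = k then C\<^sup>2 else 0)) / (real n)\<^sup>2"
    by (intro divide_right_mono sum_mono corr) simp
  also have "\<dots> = C * \<omega> + C\<^sup>2 / real n"
    using \<open>n > 0\<close> by (simp add: sum.distrib field_simps power2_eq_square)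
  also have "\<dots> \<le> \<epsilon>\<^sup>2"
    using \<omega>(2) Cn by linarith
  finally have L2: "(\<integral>w. (norm (A w))\<^sup>2 \<partial>m) \<le> \<epsilon>\<^sup>2" .
  \<comment> \<open>The inequality between arithmetic and geometric mean, integrated, turns the mean
    square bound \<open>\<epsilon>\<^sup>2\<close> into the bound \<open>\<epsilon>\<close> for the
    mean, in place of Cauchy-Schwarz.\<close>
  have "norm (A w) \<le> \<epsilon> / 2 + (norm (A w))\<^sup>2 / (2 * \<epsilon>)" for w
    using sum_squares_bound[of "norm (A w)" \<epsilon>] \<epsilon> by (simp add: field_simps power2_eq_square)
  then have "(\<integral>w. norm (A w) \<partial>m) \<le> (\<integral>w. \<epsilon> / 2 + (norm (A w))\<^sup>2 / (2 * \<epsilon>) \<partial>m)"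
    using \<epsilon> by (intro integral_mono int continuous_intros contA) auto
  also have "\<dots> = \<epsilon> / 2 + (\<integral>w. (norm (A w))\<^sup>2 \<partial>m) / (2 * \<epsilon>)"
  proof -
    have "integrable m (\<lambda>w. (norm (A w))\<^sup>2)"
      by (intro int continuous_intros contA)
    then show ?thesis
      by (simp add: prob_space)
  qed
  also have "\<dots> \<le> \<epsilon> / 2 + \<epsilon>\<^sup>2 / (2 * \<epsilon>)"
    using L2 \<epsilon> by (intro add_left_mono divide_right_mono) auto
  also have "\<dots> = \<epsilon>"
    using \<epsilon> by (simp add: power2_eq_square)
  finally show ?thesis
    using \<open>n > 0\<close> unfolding A_def K_def by blast
qed

section \<open>Dilated polynomial curves\<close>

text \<open>Parametrised by the square root \<open>s\<close> of the dilation factor, so that the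
  horizontal coordinates scale linearly.\<close>

definition heis_curve ::
    "(real \<Rightarrow> real ^ 'n::finite) \<Rightarrow> (real \<Rightarrow> real ^ 'n) \<Rightarrow> (real \<Rightarrow> real) \<Rightarrow> real \<Rightarrow> real \<Rightarrow> 'n nilmanifold"
  where "heis_curve a b c s t = nil_proj (s *\<^sub>R a t, s *\<^sub>R b t, s\<^sup>2 * c t)"

lemma continuous_heis_curve:
  assumes "continuous_on UNIV a" "continuous_on UNIV b" "continuous_on UNIV c"
  shows "continuous_on UNIV (heis_curve a b c s)"
  unfolding heis_curve_def
  by (rule continuous_on_compose2[OF continuous_nil_proj]) (auto intro!: continuous_intros assms)

text \<open>The left translation carrying the point at time \<open>t\<close> to that at
  \<open>t + \<eta>\<close>; its central coordinate is corrected by the term that the group product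
  adds.\<close>

lemma heis_curve_shift:
  "heis_curve a b c s (t + \<eta>) = nil_translate
    (s *\<^sub>R (a (t + \<eta>) - a t), s *\<^sub>R (b (t + \<eta>) - b t),
      s\<^sup>2 * (c (t + \<eta>) - c t - (a (t + \<eta>) - a t) \<bullet> b t)) (heis_curve a b c s t)"
  by (simp add: heis_curve_def nil_translate_proj heis_mult_def algebra_simps power2_eq_square)

lemma nil_equidistribution_vertical_invariant:
  fixes a b :: "real \<Rightarrow> real ^ 'n::finite" and \<Psi> :: "'n nilmanifold \<Rightarrow> real"
  assumes a: "polynomial_function a" and b: "polynomial_function b"
    and nonconst: "\<And>\<kappa>. \<kappa> \<in> int_vectors \<times> int_vectors \<Longrightarrow> \<kappa> \<noteq> 0 \<Longrightarrow>
      \<not> (\<exists>c. \<forall>t. \<kappa> \<bullet> (a t, b t) = c)"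
    and m: "invariant_prob_measure nil_translate m"
    and h: "invariant_prob_measure torus_translate (h :: 'n horizontal_torus measure)"
    and \<Psi>: "continuous_on UNIV \<Psi>" "\<And>w x. \<Psi> (nil_translate (0, 0, w) x) = \<Psi> x"
    and uv: "u \<le> v"
  shows "((\<lambda>s. integral {u..v} (\<lambda>t. \<Psi> (heis_curve a b c s t))) \<longlongrightarrow>
    (v - u) * (\<integral>x. \<Psi> x \<partial>m)) at_top"
proof -
  obtain f where f: "continuous_on UNIV f" "\<And>x. \<Psi> x = f (nil_horizontal x)"
    using vertical_invariant_descends[OF \<Psi>] by blast
  have "nil_horizontal (heis_curve a b c s t) = torus_proj (s *\<^sub>R (a t, b t))" for s t
    by (simp add: heis_curve_def nil_horizontal_proj horizontal_def)
  then show ?thesis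
    using torus_equidistribution_subinterval[OF a b nonconst h f(1) uv]
    by (simp add: f(2) integral_nil_horizontal[OF m h f(1)])
qed

context
  fixes a b a' b' :: "real \<Rightarrow> real ^ 'n::finite" and c c' :: "real \<Rightarrow> real"
    and ra rb :: "real \<times> real \<Rightarrow> real ^ 'n" and rc :: "real \<times> real \<Rightarrow> real"
    and H :: "'n nilmanifold \<Rightarrow> complex" and l :: int
  assumes cont: "continuous_on UNIV a" "continuous_on UNIV b" "continuous_on UNIV c"
      "continuous_on UNIV a'" "continuous_on UNIV b'" "continuous_on UNIV c'"
      "continuous_on UNIV ra" "continuous_on UNIV rb" "continuous_on UNIV rc"
    and taylor: "\<And>t \<eta>. a (t + \<eta>) = a t + \<eta> *\<^sub>R a' t + \<eta>\<^sup>2 *\<^sub>R ra (t, \<eta>)"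
      "\<And>t \<eta>. b (t + \<eta>) = b t + \<eta> *\<^sub>R b' t + \<eta>\<^sup>2 *\<^sub>R rb (t, \<eta>)"
      "\<And>t \<eta>. c (t + \<eta>) = c t + \<eta> * c' t + \<eta>\<^sup>2 * rc (t, \<eta>)"
    and H: "vertical_char l H" and l: "l \<noteq> 0"
begin

text \<open>Sorted by powers of \<open>s\<close> and \<open>\<eta>\<close>, this shows the two
  natural scales. If \<open>c' - a' \<bullet> b\<close> is nonzero, \<open>\<eta>\<close> of order
  \<open>1 / s\<^sup>2\<close> gives a bounded central shift with negligible horizontal part; if it
  vanishes identically, \<open>\<eta>\<close> of order \<open>1 / s\<close> keeps all coordinates
  bounded.\<close>

lemma heis_curve_increment:
  "heis_curve a b c s (t + \<eta>) = nil_translate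
    ((s * \<eta>) *\<^sub>R (a' t + \<eta> *\<^sub>R ra (t, \<eta>)), (s * \<eta>) *\<^sub>R (b' t + \<eta> *\<^sub>R rb (t, \<eta>)),
      s\<^sup>2 * \<eta> * (c' t - a' t \<bullet> b t) + (s * \<eta>)\<^sup>2 * (rc (t, \<eta>) - ra (t, \<eta>) \<bullet> b t))
    (heis_curve a b c s t)"
proof -
  have "s *\<^sub>R (a (t + \<eta>) - a t) = (s * \<eta>) *\<^sub>R (a' t + \<eta> *\<^sub>R ra (t, \<eta>))"
    "s *\<^sub>R (b (t + \<eta>) - b t) = (s * \<eta>) *\<^sub>R (b' t + \<eta> *\<^sub>R rb (t, \<eta>))"
    "s\<^sup>2 * (c (t + \<eta>) - c t - (a (t + \<eta>) - a t) \<bullet> b t) =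
      s\<^sup>2 * \<eta> * (c' t - a' t \<bullet> b t) + (s * \<eta>)\<^sup>2 * (rc (t, \<eta>) - ra (t, \<eta>) \<bullet> b t)"
    unfolding taylor by (simp_all add: algebra_simps power2_eq_square)
  then show ?thesis
    unfolding heis_curve_shift by simp
qed

lemma vertical_equicontinuous_tendsto:
  assumes "(G \<longlongrightarrow> g) F" and "e > 0"
  shows "\<forall>\<^sub>F p in F. \<forall>w. norm (H (nil_translate (G p) w) - H (nil_translate g w)) < e"
  using eventually_compose_filterlim[OF
      nil_translate_equicontinuous[OF vertical_charD(1)[OF H] assms(2)] assms(1)] .

text \<open>
  If the curve is not horizontal, the shift \<open>t + h / s\<^sup>2\<close> moves the point along the centre only,
  up to \<open>o(1)\<close>.
\<close>

lemma vertical_integral_transverse: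
  assumes q: "finite {t. c' t - a' t \<bullet> b t = 0}"
  shows "((\<lambda>s. integral {0..1} (\<lambda>t. H (heis_curve a b c s t))) \<longlongrightarrow> 0) at_top"
proof -
  obtain C where C: "\<And>x. norm (H x) \<le> C"
    by (rule bounded_on_nilmanifold[OF vertical_charD(1)[OF H]]) blast
  have contF: "continuous_on UNIV (\<lambda>t. H (heis_curve a b c s t))" for s
    using continuous_on_compose2[OF vertical_charD(1)[OF H] continuous_heis_curve] cont by blast
  show ?thesis
  proof (rule integral_tendsto_zero_sign_change[OF contF C q])
    fix x assume "x \<notin> {t. c' t - a' t \<bullet> b t = 0}"
    then have x: "c' x - a' x \<bullet> b x \<noteq> 0" by simp
    \<comment> \<open>The limiting central shift is a half period for frequency \<open>l\<close>, so
      it changes the sign of \<open>H\<close>.\<close>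
    define h where "h = 1 / (2 * of_int l * (c' x - a' x \<bullet> b x))"
    have h: "of_int l * (h * (c' x - a' x \<bullet> b x)) = 1 / 2"
      using x l by (simp add: h_def)
    let ?F = "nhds x \<times>\<^sub>F (at_top :: real filter)"
    define \<eta> where "\<eta> s = h / s\<^sup>2" for s :: real
    have \<eta>: "((\<lambda>p. \<eta> (snd p)) \<longlongrightarrow> 0) ?F"
    proof -
      have "((\<lambda>p. h / snd p * (1 / snd p)) \<longlongrightarrow> 0 * 0) ?F"
        by (intro tendsto_mult nhds_prod_at_top_limits)
      then show ?thesis
        by (simp add: \<eta>_def power2_eq_square)
    qed
    \<comment> \<open>The exact translation for the shift \<open>\<eta> s\<close>, using that
      \<open>s * \<eta> s\<close> is \<open>h / s\<close>; it converges to the central half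
      period.\<close>
    define G where "G p = (let t = fst p; s = snd p in
      ((h / s) *\<^sub>R (a' t + \<eta> s *\<^sub>R ra (t, \<eta> s)), (h / s) *\<^sub>R (b' t + \<eta> s *\<^sub>R rb (t, \<eta> s)),
        h * (c' t - a' t \<bullet> b t) + (h / s) * (h / s) * (rc (t, \<eta> s) - ra (t, \<eta> s) \<bullet> b t)))" for p
    have "(G \<longlongrightarrow> (0 *\<^sub>R (a' x + 0 *\<^sub>R ra (x, 0)), 0 *\<^sub>R (b' x + 0 *\<^sub>R rb (x, 0)),
        h * (c' x - a' x \<bullet> b x) + 0 * 0 * (rc (x, 0) - ra (x, 0) \<bullet> b x))) ?F"
      unfolding G_def Let_def
      by (intro tendsto_Pair tendsto_intros nhds_prod_at_top_limits tendsto_continuous_fst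
          tendsto_remainder \<eta> cont)
    then have G: "(G \<longlongrightarrow> (0, 0, h * (c' x - a' x \<bullet> b x))) ?F"
      by simp
    have "((\<lambda>p. H (heis_curve a b c (snd p) (fst p + \<eta> (snd p))) + H (heis_curve a b c (snd p) (fst p)))
        \<longlongrightarrow> 0) ?F"
    proof (rule tendstoI)
      fix e :: real assume "e > 0"
      from vertical_equicontinuous_tendsto[OF G this] nhds_prod_at_top_limits(3)
      show "\<forall>\<^sub>F p in ?F. dist (H (heis_curve a b c (snd p) (fst p + \<eta> (snd p))) +
        H (heis_curve a b c (snd p) (fst p))) 0 < e"
      proof eventually_elim
        case (elim p)
        have s\<eta>: "snd p * \<eta> (snd p) = h / snd p" "(snd p)\<^sup>2 * \<eta> (snd p) = h"
          using elim(2) by (simp_all add: \<eta>_def power2_eq_square)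
        have "H (heis_curve a b c (snd p) (fst p + \<eta> (snd p))) =
            H (nil_translate (G p) (heis_curve a b c (snd p) (fst p)))"
          unfolding heis_curve_increment s\<eta> by (simp add: G_def Let_def power2_eq_square)
        moreover have "H (nil_translate (0, 0, h * (c' x - a' x \<bullet> b x)) w) = - H w" for w
          unfolding vertical_charD(2)[OF H] h by simp
        ultimately show ?case
          using elim(1) by simp
      qed
    qed
    moreover have "(\<eta> \<longlongrightarrow> 0) at_top"
      unfolding \<eta>_def
      by (intro real_tendsto_divide_at_top[OF tendsto_const] filterlim_pow_at_top filterlim_ident) simp
    ultimately show "\<exists>\<eta>. (\<eta> \<longlongrightarrow> 0) at_top \<and>
      ((\<lambda>p. H (heis_curve a b c (snd p) (fst p + \<eta> (snd p))) + H (heis_curve a b c (snd p) (fst p)))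
        \<longlongrightarrow> 0) ?F"
      by blast
  qed simp
qed

text \<open>
  If the curve is horizontal, then near \<open>x\<close> and at scale \<open>h / s\<close> it follows the flow
  \<open>g h = (h a' x, h b' x, O(h\<^sup>2))\<close>, with a limit independent of \<open>s\<close>.
\<close>

lemma vertical_integral_horizontal:
  assumes q: "\<And>t. c' t - a' t \<bullet> b t = 0" and a'i: "finite {t. a' t $ i = 0}"
    and m: "invariant_prob_measure nil_translate m"
    and equi: "\<And>\<Psi> u v. continuous_on UNIV \<Psi> \<Longrightarrow> (\<And>w x. \<Psi> (nil_translate (0, 0, w) x) = \<Psi> x) \<Longrightarrow>
      u \<le> v \<Longrightarrow> ((\<lambda>s. integral {u..v} (\<lambda>t. \<Psi> (heis_curve a b c s t))) \<longlongrightarrow>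
        (v - u) * (\<integral>x. \<Psi> x \<partial>m)) at_top"
  shows "((\<lambda>s. integral {0..1} (\<lambda>t. H (heis_curve a b c s t))) \<longlongrightarrow> 0) at_top"
proof -
  obtain C where C: "\<And>x. norm (H x) \<le> C"
    by (rule bounded_on_nilmanifold[OF vertical_charD(1)[OF H]]) blast
  note contH = continuous_on_compose2[OF vertical_charD(1)[OF H]]
  note contcurve = continuous_heis_curve[OF cont(1-3)]
  have contF: "continuous_on UNIV (\<lambda>t. H (heis_curve a b c s t))" for s
    using contH[OF contcurve] by simp
  show ?thesis
  proof (rule integral_tendsto_zero_locally[OF contF C a'i])
    fix x \<epsilon> :: real assume "x \<notin> {t. a' t $ i = 0}" and \<epsilon>: "\<epsilon> > 0"
    then have x: "a' x $ i \<noteq> 0" by simp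
    define g where "g h = (h *\<^sub>R a' x, h *\<^sub>R b' x, h * h * (rc (x, 0) - ra (x, 0) \<bullet> b x))" for h
    have "fst (g h) = h *\<^sub>R a' x" for h
      by (simp add: g_def)
    from vertical_average_small[OF H l m this x, of "\<epsilon> / 4"] obtain n T where n: "n > 0" and
      small: "(\<integral>w. norm ((\<Sum>j<n. H (nil_translate (g (real j * T)) w)) / of_nat n) \<partial>m) \<le> \<epsilon> / 4"
      using \<epsilon> by auto
    define A where "A w = (\<Sum>j<n. H (nil_translate (g (real j * T)) w)) / of_nat n" for w
    have contA: "continuous_on UNIV A"
      unfolding A_def using n
      by (intro continuous_intros contH[OF continuous_nil_translate]) auto
    \<comment> \<open>The translates in \<open>A\<close> commute with the centre, so
      \<open>A\<close> is again a vertical character; its norm is centre-invariant and thus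
      controlled by the torus.\<close>
    have normA: "norm (A (nil_translate (0, 0, w) y)) = norm (A y)" for w y
    proof -
      have "A (nil_translate (0, 0, w) y) = ei (of_int l * w) * A y"
        unfolding A_def nil_translate_center vertical_charD(2)[OF H] by (simp add: sum_distrib_left)
      then show ?thesis by (simp add: norm_mult)
    qed
    have contAc: "continuous_on UNIV (\<lambda>t. A (heis_curve a b c s t))" for s
      using continuous_on_compose2[OF contA contcurve] by simp
    let ?F = "nhds x \<times>\<^sub>F (at_top :: real filter)"
    have "\<exists>d>0. \<forall>u v. u \<le> x \<and> x \<le> v \<and> v - u < d \<longrightarrow>
      (\<forall>\<^sub>F s in at_top. norm (integral {u..v} (\<lambda>t. H (heis_curve a b c s t)) -
        integral {u..v} (\<lambda>t. A (heis_curve a b c s t))) \<le> \<epsilon> / 4 * (v - u))"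
    proof (rule integral_shift_average[OF contF C contAc n, where \<eta> = "\<lambda>j s. real j * T / s"])
      show "((\<lambda>s. real j * T / s) \<longlongrightarrow> 0) at_top" for j
        by (intro real_tendsto_divide_at_top[OF tendsto_const] filterlim_ident)
      show "\<epsilon> / 4 > 0" using \<epsilon> by simp
      fix e :: real assume e: "e > 0"
      have "\<forall>\<^sub>F p in ?F. \<forall>j\<in>{..<n}. norm (H (heis_curve a b c (snd p) (fst p + real j * T / snd p)) -
          H (nil_translate (g (real j * T)) (heis_curve a b c (snd p) (fst p)))) < e"
      proof (intro eventually_ball_finite ballI)
        fix j
        define h where "h = real j * T"
        \<comment> \<open>The exact translation for the shift \<open>h / s\<close>: the first-order
          central term vanishes by \<open>q\<close>, and \<open>s * \<eta> = h\<close> removes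
          \<open>s\<close> except through \<open>\<eta>\<close>.\<close>
        define G where "G p = (let t = fst p; \<eta> = h / snd p in
          (h *\<^sub>R (a' t + \<eta> *\<^sub>R ra (t, \<eta>)), h *\<^sub>R (b' t + \<eta> *\<^sub>R rb (t, \<eta>)),
            h * h * (rc (t, \<eta>) - ra (t, \<eta>) \<bullet> b t)))" for p
        have "(G \<longlongrightarrow> (h *\<^sub>R (a' x + 0 *\<^sub>R ra (x, 0)), h *\<^sub>R (b' x + 0 *\<^sub>R rb (x, 0)),
            h * h * (rc (x, 0) - ra (x, 0) \<bullet> b x))) ?F"
          unfolding G_def Let_def
          by (intro tendsto_Pair tendsto_intros nhds_prod_at_top_limits tendsto_continuous_fst
              tendsto_remainder cont)
        then have "(G \<longlongrightarrow> g h) ?F"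
          by (simp add: g_def)
        from vertical_equicontinuous_tendsto[OF this e] nhds_prod_at_top_limits(3)
        have "\<forall>\<^sub>F p in ?F. norm (H (heis_curve a b c (snd p) (fst p + h / snd p)) -
          H (nil_translate (g h) (heis_curve a b c (snd p) (fst p)))) < e"
        proof eventually_elim
          case (elim p)
          have s\<eta>: "snd p * (h / snd p) = h"
            using elim(2) by simp
          have "H (heis_curve a b c (snd p) (fst p + h / snd p)) =
              H (nil_translate (G p) (heis_curve a b c (snd p) (fst p)))"
            unfolding heis_curve_increment s\<eta> q by (simp add: G_def Let_def power2_eq_square)
          then show ?case
            using elim(1) by simp
        qed
        then show "\<forall>\<^sub>F p in ?F. norm (H (heis_curve a b c (snd p) (fst p + real j * T / snd p)) -
          H (nil_translate (g (real j * T)) (heis_curve a b c (snd p) (fst p)))) < e"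
          by (simp add: h_def)
      qed simp
      then show "\<forall>\<^sub>F p in ?F.
        norm ((\<Sum>j<n. H (heis_curve a b c (snd p) (fst p + real j * T / snd p))) / of_nat n -
          A (heis_curve a b c (snd p) (fst p))) \<le> e"
      proof eventually_elim
        case (elim p)
        let ?d = "\<lambda>j. H (heis_curve a b c (snd p) (fst p + real j * T / snd p)) -
          H (nil_translate (g (real j * T)) (heis_curve a b c (snd p) (fst p)))"
        have "norm (\<Sum>j<n. ?d j) \<le> real n * e"
          using sum_norm_bound[of "{..<n}" ?d e] elim by (simp add: less_imp_le)
        then have "norm ((\<Sum>j<n. ?d j) / of_nat n) \<le> e"
          using n by (simp add: norm_divide divide_le_eq mult.commute)
        then show ?case
          by (simp add: A_def sum_subtractf diff_divide_distrib)
      qed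
    qed
    then obtain d where d: "d > 0" and
      diff: "\<And>u v. u \<le> x \<Longrightarrow> x \<le> v \<Longrightarrow> v - u < d \<Longrightarrow>
        \<forall>\<^sub>F s in at_top. norm (integral {u..v} (\<lambda>t. H (heis_curve a b c s t)) -
          integral {u..v} (\<lambda>t. A (heis_curve a b c s t))) \<le> \<epsilon> / 4 * (v - u)"
      by blast
    have "\<forall>\<^sub>F s in at_top. norm (integral {u..v} (\<lambda>t. H (heis_curve a b c s t))) \<le> \<epsilon> * (v - u)"
      if uv: "u \<le> x" "x \<le> v" "v - u < d" for u v
    proof (cases "u = v")
      case True
      then show ?thesis by simp
    next
      case False
      then have "u < v" using uv by simp
      have contnA: "continuous_on UNIV (\<lambda>w. norm (A w))"
        by (intro continuous_intros contA)
      \<comment> \<open>The mean is at most \<open>\<epsilon> / 4\<close>; the strict gap to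
        \<open>\<epsilon> / 2\<close>, available as \<open>u < v\<close>, allows the limit along the
        curve to be replaced by an eventual bound.\<close>
      have "(v - u) * (\<integral>w. norm (A w) \<partial>m) \<le> (v - u) * (\<epsilon> / 4)"
        using small \<open>u < v\<close> by (intro mult_left_mono) (auto simp: A_def)
      also have "\<dots> < \<epsilon> / 2 * (v - u)"
        using \<open>u < v\<close> \<epsilon> by (simp add: field_simps)
      finally have "\<forall>\<^sub>F s in at_top. integral {u..v} (\<lambda>t. norm (A (heis_curve a b c s t))) < \<epsilon> / 2 * (v - u)"
        by (rule order_tendstoD(2)[OF equi[OF contnA normA less_imp_le[OF \<open>u < v\<close>]]])
      with diff[OF uv] show ?thesis
      proof eventually_elim
        case (elim s)
        have intA: "(\<lambda>t. A (heis_curve a b c s t)) integrable_on {u..v}"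
          "(\<lambda>t. norm (A (heis_curve a b c s t))) integrable_on {u..v}"
          by (intro integrable_continuous_interval continuous_intros
              continuous_on_subset[OF contAc]; simp)+
        have "norm (integral {u..v} (\<lambda>t. A (heis_curve a b c s t))) \<le>
            integral {u..v} (\<lambda>t. norm (A (heis_curve a b c s t)))"
          by (rule integral_norm_bound_integral[OF intA]) simp
        then have "norm (integral {u..v} (\<lambda>t. H (heis_curve a b c s t))) \<le>
            \<epsilon> / 4 * (v - u) + \<epsilon> / 2 * (v - u)"
          using elim norm_triangle_sub[of "integral {u..v} (\<lambda>t. H (heis_curve a b c s t))"
              "integral {u..v} (\<lambda>t. A (heis_curve a b c s t))"] by linarith
        also have "\<dots> \<le> \<epsilon> * (v - u)"
          using \<epsilon> \<open>u < v\<close> by (simp add: field_simps)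
        finally show ?case .
      qed
    qed
    then show "\<exists>d>0. \<forall>u v. u \<le> x \<and> x \<le> v \<and> v - u < d \<longrightarrow>
      (\<forall>\<^sub>F s in at_top. norm (integral {u..v} (\<lambda>t. H (heis_curve a b c s t))) \<le> \<epsilon> * (v - u))"
      using d by blast
  qed simp
qed

end

section \<open>Combining the frequencies; the equivalence\<close>

lemma vertical_char_integral_zero:
  assumes m: "invariant_prob_measure nil_translate m" and H: "vertical_char l H" and l: "l \<noteq> 0"
  shows "(\<integral>x. Re (H x) \<partial>m) = 0"
proof -
  have "continuous_on UNIV (\<lambda>x. Re (H x))"
    by (intro continuous_intros vertical_charD(1)[OF H])
  from invariant_integral[OF m continuous_nil_translate this, of "(0, 0, 1 / (2 * of_int l))"]
  show ?thesis
    using l by (simp add: vertical_charD(2)[OF H])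
qed

lemma nil_equidistribution_vertical_char:
  fixes a b :: "real \<Rightarrow> real ^ 'n::finite"
  assumes a: "polynomial_function a" and b: "polynomial_function b"
    and c: "real_polynomial_function c"
    and nonconst: "\<And>\<kappa>. \<kappa> \<in> int_vectors \<times> int_vectors \<Longrightarrow> \<kappa> \<noteq> 0 \<Longrightarrow>
      \<not> (\<exists>c. \<forall>t. \<kappa> \<bullet> (a t, b t) = c)"
    and m: "invariant_prob_measure nil_translate m"
    and h: "invariant_prob_measure torus_translate (h :: 'n horizontal_torus measure)"
    and H: "vertical_char l H"
  shows "((\<lambda>s. integral {0..1} (\<lambda>t. Re (H (heis_curve a b c s t)))) \<longlongrightarrow> (\<integral>x. Re (H x) \<partial>m)) at_top"
proof (cases "l = 0")
  case True
  have "continuous_on UNIV (\<lambda>x. Re (H x))"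
    by (intro continuous_intros vertical_charD(1)[OF H])
  moreover have "Re (H (nil_translate (0, 0, w) x)) = Re (H x)" for w x
    by (simp add: vertical_charD(2)[OF H] True)
  ultimately show ?thesis
    using nil_equidistribution_vertical_invariant[OF a b nonconst m h, of "\<lambda>x. Re (H x)" 0 1 c]
    by simp
next
  case False
  obtain a' ra where a': "\<And>i. real_polynomial_function (\<lambda>t. a' t $ i)" "continuous_on UNIV ra"
    "\<And>t \<eta>. a (t + \<eta>) = a t + \<eta> *\<^sub>R a' t + \<eta>\<^sup>2 *\<^sub>R ra (t, \<eta>)"
    "\<And>i. (\<And>t. a' t $ i = 0) \<Longrightarrow> \<exists>c. \<forall>t. a t $ i = c"
    using a by (rule polynomial_function_taylor) blast
  obtain b' rb where b': "\<And>i. real_polynomial_function (\<lambda>t. b' t $ i)" "continuous_on UNIV rb"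
    "\<And>t \<eta>. b (t + \<eta>) = b t + \<eta> *\<^sub>R b' t + \<eta>\<^sup>2 *\<^sub>R rb (t, \<eta>)"
    using b by (rule polynomial_function_taylor) blast
  obtain c' rc where c': "real_polynomial_function c'" "continuous_on UNIV rc"
    "\<And>t \<eta>. c (t + \<eta>) = c t + \<eta> * c' t + \<eta>\<^sup>2 * rc (t, \<eta>)"
    using c by (rule real_polynomial_function_taylor) blast
  have cont: "continuous_on UNIV a" "continuous_on UNIV b" "continuous_on UNIV c"
      "continuous_on UNIV a'" "continuous_on UNIV b'" "continuous_on UNIV c'"
    using a b c c'(1) a'(1) b'(1)
    by (auto intro: continuous_on_polymonial_function continuous_on_real_polynomial_function
        continuous_on_vec_lambda[where f = "\<lambda>i t. a' t $ i", simplified vec_nth_inverse]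
        continuous_on_vec_lambda[where f = "\<lambda>i t. b' t $ i", simplified vec_nth_inverse])
  note setting = cont a'(2) b'(2) c'(2) a'(3) b'(3) c'(3) H False
  have "((\<lambda>s. integral {0..1} (\<lambda>t. H (heis_curve a b c s t))) \<longlongrightarrow> 0) at_top"
  proof (cases "\<forall>t. c' t - a' t \<bullet> b t = 0")
    case True
    \<comment> \<open>Any coordinate serves: the frequency with a unit vector in the
      \<open>x\<close>-direction shows that this coordinate of \<open>a\<close> is nonconstant, as
      the averaging argument requires.\<close>
    fix i :: 'n
    have "axis i 1 \<in> (int_vectors :: (real ^ 'n) set)"
      by (auto simp: int_vectors_def axis_def)
    then have "\<not> (\<exists>c. \<forall>t. (axis i 1, 0) \<bullet> (a t, b t) = c)"
      using nonconst[of "(axis i 1, 0)"] by (simp add: int_vectors_zero zero_prod_def axis_eq_0_iff)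
    then have "\<not> (\<exists>c. \<forall>t. a t $ i = c)"
      by (simp add: inner_axis')
    then obtain t where "a' t $ i \<noteq> 0"
      using a'(4) by blast
    then have "finite {t. a' t $ i = 0}"
      by (rule real_polynomial_function_finite_zeros[OF a'(1)])
    then show ?thesis
      using vertical_integral_horizontal[OF setting _ _ m] True
        nil_equidistribution_vertical_invariant[OF a b nonconst m h] by blast
  next
    case False
    have "real_polynomial_function ((\<lambda>v. v $ i) \<circ> b)" for i
      using b bounded_linear_vec_nth unfolding polynomial_function_def by blast
    then have "real_polynomial_function (\<lambda>t. c' t - a' t \<bullet> b t)"
      unfolding inner_vec_def inner_real_def
      by (intro real_polynomial_function_diff real_polynomial_function_sum
          real_polynomial_function.intros(4) c' a') (simp_all add: o_def)
    then have "finite {t. c' t - a' t \<bullet> b t = 0}"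
      using False real_polynomial_function_finite_zeros by blast
    then show ?thesis
      using vertical_integral_transverse[OF setting] by blast
  qed
  then have "((\<lambda>s. Re (integral {0..1} (\<lambda>t. H (heis_curve a b c s t)))) \<longlongrightarrow> Re 0) at_top"
    by (rule tendsto_Re)
  moreover have "Re (integral {0..1} (\<lambda>t. H (heis_curve a b c s t))) =
      integral {0..1} (\<lambda>t. Re (H (heis_curve a b c s t)))" for s
  proof -
    have "continuous_on UNIV (\<lambda>t. H (heis_curve a b c s t))"
      using continuous_on_compose2[OF vertical_charD(1)[OF H] continuous_heis_curve] cont by blast
    then have "(\<lambda>t. H (heis_curve a b c s t)) integrable_on {0..1}"
      by (intro integrable_continuous_interval) (rule continuous_on_subset, auto)
    from integral_linear[OF this bounded_linear_Re] show ?thesis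
      by (simp add: o_def)
  qed
  ultimately show ?thesis
    by (simp add: vertical_char_integral_zero[OF m H False])
qed

theorem theorem6:
  fixes a b :: "real \<Rightarrow> real ^ 'n::finite"
    and c :: "real \<Rightarrow> real"
    and p :: "real \<Rightarrow> 'n heis"
    and m :: "'n nilmanifold measure"
    and h :: "'n horizontal_torus measure"
  assumes "polynomial_function a"
    and "polynomial_function b"
    and "real_polynomial_function c"
    and "\<And>t. p t = (a t, b t, c t)"
    and "invariant_prob_measure nil_translate m"
    and "invariant_prob_measure torus_translate h"
  shows "weak_star_tendsto (nil_dilation_measure p) m at_top \<longleftrightarrow>
         weak_star_tendsto (torus_dilation_measure p) h at_top"
proof
  note a = assms(1) and b = assms(2) and c = assms(3) and p = assms(4) and m = assms(5) and h = assms(6)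
  have cont: "continuous_on UNIV a" "continuous_on UNIV b" "continuous_on UNIV c"
    using a b c by (auto intro: continuous_on_polymonial_function continuous_on_real_polynomial_function)
  \<comment> \<open>For \<open>r \<ge> 0\<close> the square of \<open>sqrt r\<close> is
    \<open>r\<close>; negative \<open>r\<close> are irrelevant for limits at
    \<open>at_top\<close>.\<close>
  have nil_curve: "nil_proj (heis_dilate r (p t)) = heis_curve a b c (sqrt r) t" if "r \<ge> 0" for r t
    using that by (simp add: p heis_dilate_def heis_curve_def)
  have nil_integral: "(\<integral>x. f x \<partial>nil_dilation_measure p r) =
      integral {0..1} (\<lambda>t. f (heis_curve a b c (sqrt r) t))"
    if "continuous_on UNIV f" "r \<ge> 0" for f :: "'n nilmanifold \<Rightarrow> real" and r
    unfolding nil_dilation_measure_def nil_curve[OF that(2)]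
    by (rule integral_distr_curve[OF continuous_heis_curve[OF cont] that(1)])
  have contA: "continuous_on UNIV (\<lambda>t. (a t, b t))"
    by (intro continuous_intros cont)
  have hor: "horizontal (heis_dilate r (p t)) = sqrt r *\<^sub>R (a t, b t)" for r t
    by (simp add: p heis_dilate_def horizontal_def)
  have torus_integral: "(\<integral>x. f x \<partial>torus_dilation_measure p r) =
      integral {0..1} (\<lambda>t. f (torus_proj (sqrt r *\<^sub>R (a t, b t))))"
    if "continuous_on UNIV f" for f :: "'n horizontal_torus \<Rightarrow> real" and r
    unfolding torus_dilation_measure_def hor
    by (rule integral_distr_curve[OF continuous_scale_curve[OF contA] that])
  {
    assume nil: "weak_star_tendsto (nil_dilation_measure p) m at_top"
    show "weak_star_tendsto (torus_dilation_measure p) h at_top"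
      unfolding weak_star_tendsto_def
    proof (intro allI impI)
      fix f :: "'n horizontal_torus \<Rightarrow> real" assume f: "continuous_on UNIV f"
      \<comment> \<open>Torus test functions are pulled back to the nilmanifold, where convergence
        is assumed.\<close>
      have cont_f: "continuous_on UNIV (\<lambda>x. f (nil_horizontal x))"
        using continuous_on_compose2[OF f continuous_nil_horizontal] by simp
      then have "((\<lambda>r. \<integral>x. f (nil_horizontal x) \<partial>nil_dilation_measure p r) \<longlongrightarrow>
          (\<integral>x. f (nil_horizontal x) \<partial>m)) at_top"
        using nil unfolding weak_star_tendsto_def by blast
      moreover have "\<forall>\<^sub>F r in at_top. (\<integral>x. f (nil_horizontal x) \<partial>nil_dilation_measure p r) =
          (\<integral>x. f x \<partial>torus_dilation_measure p r)"
        using eventually_ge_at_top[of 0]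
      proof eventually_elim
        case (elim r)
        then show ?case
          unfolding nil_integral[OF cont_f elim] torus_integral[OF f]
          by (simp add: heis_curve_def nil_horizontal_proj horizontal_def)
      qed
      ultimately show "((\<lambda>r. \<integral>x. f x \<partial>torus_dilation_measure p r) \<longlongrightarrow> (\<integral>x. f x \<partial>h)) at_top"
        unfolding integral_nil_horizontal[OF m h f] by (rule Lim_transform_eventually)
    qed
  next
    assume torus: "weak_star_tendsto (torus_dilation_measure p) h at_top"
    note nonconst = torus_dilation_nonconstant[OF contA p h torus]
    \<comment> \<open>Convergence is shown in the parameter \<open>s\<close> on the dense family of
      vertical characters; substituting \<open>s = sqrt r\<close> afterwards returns to the dilation
      parameter.\<close>
    have lim: "((\<lambda>s. integral {0..1} (\<lambda>t. f (heis_curve a b c s t))) \<longlongrightarrow> (\<integral>x. f x \<partial>m)) at_top"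
      if f: "continuous_on UNIV f" for f :: "'n nilmanifold \<Rightarrow> real"
    proof (rule bounded_functional_tendsto[OF _ _ continuous_vertical_chars vertical_chars_dense _ f])
      show "bounded_functional 1 (\<lambda>f. integral {0..1} (\<lambda>t. f (heis_curve a b c s t)))" for s
        using bounded_functional_curve[OF continuous_heis_curve[OF cont], of 0 1] by simp
      show "bounded_functional 1 (\<lambda>f. \<integral>x. f x \<partial>m)"
        by (rule bounded_functional_integral[OF compact_nilmanifold invariant_prob_measureD[OF m]])
      show "((\<lambda>s. integral {0..1} (\<lambda>t. Re (H (heis_curve a b c s t)))) \<longlongrightarrow> (\<integral>x. Re (H x) \<partial>m)) at_top"
        if "H \<in> vertical_chars" for H
        using that nil_equidistribution_vertical_char[OF a b c nonconst m h]
        unfolding vertical_chars_def by blast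
    qed
    show "weak_star_tendsto (nil_dilation_measure p) m at_top"
      unfolding weak_star_tendsto_def
    proof (intro allI impI)
      fix f :: "'n nilmanifold \<Rightarrow> real" assume f: "continuous_on UNIV f"
      have "((\<lambda>r. integral {0..1} (\<lambda>t. f (heis_curve a b c (sqrt r) t))) \<longlongrightarrow> (\<integral>x. f x \<partial>m)) at_top"
        by (rule filterlim_compose[OF lim[OF f] sqrt_at_top])
      moreover have "\<forall>\<^sub>F r in at_top. integral {0..1} (\<lambda>t. f (heis_curve a b c (sqrt r) t)) =
          (\<integral>x. f x \<partial>nil_dilation_measure p r)"
        using eventually_ge_at_top[of 0] by eventually_elim (simp add: nil_integral[OF f])
      ultimately show "((\<lambda>r. \<integral>x. f x \<partial>nil_dilation_measure p r) \<longlongrightarrow> (\<integral>x. f x \<partial>m)) at_top"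
        by (rule Lim_transform_eventually)
    qed
  }
qed

end
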